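(* Let $l>0$ and let $f_0\in H^3(\mathbb{T})$ be odd and satisfy the stability condition $\frac{1}{1+(\partial_x f_0(x))^2}>\frac{1}{1+l^2-(f_0(x))^2}$ for all $x$ (with $\|f_0\|_{L^\infty}<l$). Then there exists $\delta>0$ such that if $\|f_0\|_{H^3(\mathbb{T})}\leq\delta$, the solution of $$\partial_t f=\left(-\frac{1}{1+(\partial_x f)^2}+\frac{1}{1+l^2-f^2}\right)\Lambda f,\qquad f(\cdot,0)=f_0,$$ exists globally in time and satisfies $$\|f(t)\|_{C^1(\mathbb{T})}\leq\frac{l}{4}e^{-\mathcal{C}_l t}\quad\text{for all }t\ge0,\qquad \mathcal{C}_l=\frac{l^2}{1+l^2}.$$
   Context: $\Lambda=\sqrt{-\partial_x^2}$ is the operator with Fourier symbol $|\xi|$. *)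

theory Defs
  imports "HOL-Analysis.Analysis"
begin

text \<open>The torus T is identified with R / 2 pi Z; functions on T are 2 pi-periodic real functions.\<close>

definition periodic2pi :: "(real \<Rightarrow> real) \<Rightarrow> bool" where
  "periodic2pi f \<longleftrightarrow> (\<forall>x. f (x + 2 * pi) = f x)"

definition fourier_coeff :: "(real \<Rightarrow> real) \<Rightarrow> int \<Rightarrow> complex" where
  "fourier_coeff f k =
     integral {-pi..pi} (\<lambda>x. complex_of_real (f x) * cis (- (of_int k * x))) / complex_of_real (2 * pi)"

definition in_H3 :: "(real \<Rightarrow> real) \<Rightarrow> bool" where
  "in_H3 f \<longleftrightarrow> periodic2pi f \<and> continuous_on UNIV f \<and>
     (\<lambda>k::int. (1 + (real_of_int k)^2)^3 * (cmod (fourier_coeff f k))^2) summable_on UNIV"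

definition H3_norm :: "(real \<Rightarrow> real) \<Rightarrow> real" where
  "H3_norm f = sqrt (\<Sum>\<^sub>\<infinity>k::int. (1 + (real_of_int k)^2)^3 * (cmod (fourier_coeff f k))^2)"

text \<open>Lambda = sqrt(-d^2/dx^2), Fourier multiplier with symbol |k|.\<close>
definition Lambda :: "(real \<Rightarrow> real) \<Rightarrow> real \<Rightarrow> real" where
  "Lambda f x = Re (\<Sum>\<^sub>\<infinity>k::int. complex_of_int \<bar>k\<bar> * fourier_coeff f k * cis (of_int k * x))"

definition C1_norm :: "(real \<Rightarrow> real) \<Rightarrow> real" where
  "C1_norm g = (SUP x. \<bar>g x\<bar>) + (SUP x. \<bar>deriv g x\<bar>)"

end

theory Submission
  imports Defs "HOL-Real_Asymp.Real_Asymp"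
begin

text \<open>
  Write \<open>C = l^2 / (1 + l^2)\<close> and \<open>L = 1 + l^2\<close>. The equation is \<open>f_t = - C \<Lambda>f + (Q + P) \<Lambda>f\<close> with
  \<open>Q = f_x^2 / (1 + f_x^2)\<close> and \<open>P = 1 / (L - f^2) - 1 / L\<close>, so the nonlinearity is cubic. On the
  Fourier side one looks for coefficients of size \<open>exp (- C t (|k| + 1) / 2) / |k|^3\<close>. This weight
  is met at \<open>t = 0\<close> by small data in \<open>H^3\<close>; it decays like \<open>exp (- C t)\<close> for \<open>|k| \<ge> 1\<close>, and oddness
  removes the mode \<open>k = 0\<close>; and it makes \<open>f t\<close> analytic for \<open>t > 0\<close>. Since \<open>|k|\<close> is subadditive,
  sequences dominated by \<open>exp (- c |k|) / (1 + |k|)^2\<close> form an algebra under convolution, and a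
  product of three factors gains an extra \<open>exp (- C t)\<close>. The Duhamel integral against
  \<open>exp (- C |k| (t - s))\<close> regains the power of \<open>|k|\<close> lost to \<open>\<Lambda>f\<close>. Hence the Duhamel map is a
  contraction of a small ball in a weighted sup norm, and the Fourier series of its fixed point may
  be differentiated termwise.
\<close>

section \<open>Infinite sums\<close>

lemma summable_on_dominated:
  fixes f :: "'a \<Rightarrow> 'b::banach"
  assumes "M summable_on X" "\<And>x. x \<in> X \<Longrightarrow> norm (f x) \<le> M x"
  shows "f summable_on X"
  by (rule abs_summable_summable) (rule Infinite_Sum.abs_summable_on_comparison_test'[OF assms])

lemma norm_infsum_dominated:
  fixes f :: "'a \<Rightarrow> 'b::banach"
  assumes "M summable_on X" "\<And>x. x \<in> X \<Longrightarrow> norm (f x) \<le> M x"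
  shows "norm (\<Sum>\<^sub>\<infinity>x\<in>X. f x) \<le> (\<Sum>\<^sub>\<infinity>x\<in>X. M x)"
  by (rule norm_infsum_le[OF has_sum_infsum has_sum_infsum])
     (use summable_on_dominated assms in auto)

lemma continuous_on_infsum_dominated:
  fixes f :: "'a \<Rightarrow> 'b::topological_space \<Rightarrow> 'c::banach"
  assumes "\<And>x. x \<in> X \<Longrightarrow> continuous_on Y (f x)" "M summable_on X"
    and "\<And>x y. x \<in> X \<Longrightarrow> y \<in> Y \<Longrightarrow> norm (f x y) \<le> M x"
  shows "continuous_on Y (\<lambda>y. \<Sum>\<^sub>\<infinity>x\<in>X. f x y)"
proof (rule uniform_limit_theorem)
  show "uniform_limit Y (\<lambda>X y. \<Sum>x\<in>X. f x y) (\<lambda>y. \<Sum>\<^sub>\<infinity>x\<in>X. f x y) (finite_subsets_at_top X)"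
    by (rule Weierstrass_m_test_general) (use assms in auto)
  show "\<forall>\<^sub>F n in finite_subsets_at_top X. continuous_on Y (\<lambda>y. \<Sum>x\<in>n. f x y)"
    by (rule eventually_finite_subsets_at_top_weakI)
       (use assms(1) in \<open>auto intro!: continuous_on_sum\<close>)
qed simp

lemma infsum_diff:
  fixes f g :: "'a \<Rightarrow> 'b::{topological_ab_group_add,t2_space}"
  assumes "f summable_on X" "g summable_on X"
  shows "(\<Sum>\<^sub>\<infinity>x\<in>X. f x - g x) = (\<Sum>\<^sub>\<infinity>x\<in>X. f x) - (\<Sum>\<^sub>\<infinity>x\<in>X. g x)"
  using infsum_add[OF assms(1), of "\<lambda>x. - g x"] assms(2) by (simp add: infsum_uminus summable_on_uminus)

lemma has_sum_integral_dominated: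
  fixes f :: "'a \<Rightarrow> real \<Rightarrow> 'b::banach"
  assumes cont: "\<And>k. continuous_on {a..b} (f k)" and summable_M: "M summable_on UNIV"
    and bound: "\<And>k x. x \<in> {a..b} \<Longrightarrow> norm (f k x) \<le> M k"
  shows "((\<lambda>k. integral {a..b} (f k)) has_sum integral {a..b} (\<lambda>x. \<Sum>\<^sub>\<infinity>k. f k x)) UNIV"
proof -
  have "uniform_limit {a..b} (\<lambda>X x. \<Sum>k\<in>X. f k x) (\<lambda>x. \<Sum>\<^sub>\<infinity>k. f k x) (finite_subsets_at_top UNIV)"
    using bound summable_M by (intro Weierstrass_m_test_general) auto
  moreover have "continuous_on {a..b} (\<lambda>x. \<Sum>k\<in>X. f k x)" for X
    by (intro continuous_on_sum cont)
  ultimately obtain I J where integral_partial_sum: "\<And>X. ((\<lambda>x. \<Sum>k\<in>X. f k x) has_integral I X) {a..b}"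
    and integral_limit: "((\<lambda>x. \<Sum>\<^sub>\<infinity>k. f k x) has_integral J) {a..b}"
    and lim: "(I \<longlongrightarrow> J) (finite_subsets_at_top UNIV)"
    by (rule uniform_limit_integral) auto
  have "I X = (\<Sum>k\<in>X. integral {a..b} (f k))" if "finite X" for X
    using integral_unique[OF integral_partial_sum[of X]] that cont
    by (simp add: integral_sum integrable_continuous_real)
  then have "((\<lambda>X. \<Sum>k\<in>X. integral {a..b} (f k)) \<longlongrightarrow> J) (finite_subsets_at_top UNIV)"
    using lim by (elim Lim_transform_eventually) (auto intro: eventually_finite_subsets_at_top_weakI)
  then show ?thesis
    by (simp add: has_sum_def integral_unique[OF integral_limit])
qed

lemma summable_on_int_abs:
  fixes f :: "nat \<Rightarrow> 'a::{ab_group_add,topological_comm_monoid_add,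
    uniform_topological_group_add,complete_uniform_space}"
  assumes "f summable_on UNIV"
  shows "(\<lambda>k::int. f (nat \<bar>k\<bar>)) summable_on UNIV"
proof -
  have "(\<lambda>k::int. f (nat \<bar>k\<bar>)) summable_on range int"
    using assms by (subst summable_on_reindex) (auto simp: o_def)
  moreover have "(\<lambda>k::int. f (nat \<bar>k\<bar>)) summable_on range (\<lambda>n. - int n)"
    using assms by (subst summable_on_reindex) (auto simp: o_def inj_def)
  moreover have "(UNIV :: int set) = range int \<union> range (\<lambda>n. - int n)"
    by (auto simp: image_iff) (metis int_cases2)
  ultimately show ?thesis
    by (metis summable_on_union[of "\<lambda>k::int. f (nat \<bar>k\<bar>)"])
qed

lemma bij_diff_left: "bij (\<lambda>j::'a::ab_group_add. k - j)"
  by (rule bij_betwI[where g = "\<lambda>j. k - j"]) auto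

lemma infsum_diff_left:
  fixes f :: "'i::ab_group_add \<Rightarrow> 'a::{comm_monoid_add,t2_space}"
  shows "(\<Sum>\<^sub>\<infinity>j. f (k - j)) = (\<Sum>\<^sub>\<infinity>j. f j)"
  by (rule infsum_reindex_bij_betw[OF bij_diff_left])

lemma sums_int_decode:
  fixes f :: "int \<Rightarrow> 'a::{comm_monoid_add,t2_space}"
  assumes "f summable_on UNIV"
  shows "(\<lambda>n. f (int_decode n)) sums (\<Sum>\<^sub>\<infinity>k. f k)"
proof -
  have "((\<lambda>n. f (int_decode n)) has_sum (\<Sum>\<^sub>\<infinity>k. f k)) UNIV"
    by (subst has_sum_reindex_bij_betw[OF bij_int_decode]) (rule has_sum_infsum[OF assms])
  then show ?thesis by (rule has_sum_imp_sums)
qed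

lemma has_vector_derivative_infsum_int:
  fixes f :: "int \<Rightarrow> real \<Rightarrow> 'a::banach"
  assumes "convex S" and deriv: "\<And>k x. x \<in> S \<Longrightarrow> (f k has_vector_derivative f' k x) (at x within S)"
    and summable_M: "M summable_on UNIV" and bound: "\<And>k x. x \<in> S \<Longrightarrow> norm (f' k x) \<le> M k"
    and summable_f: "\<And>x. x \<in> S \<Longrightarrow> (\<lambda>k. f k x) summable_on UNIV" and x_in_S: "x \<in> S"
  shows "((\<lambda>x. \<Sum>\<^sub>\<infinity>k. f k x) has_vector_derivative (\<Sum>\<^sub>\<infinity>k. f' k x)) (at x within S)"
proof -
  have summable_f': "(\<lambda>k. f' k y) summable_on UNIV" if "y \<in> S" for y
    using summable_M bound[OF that] by (rule summable_on_dominated)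
  have "uniform_limit S (\<lambda>n y. \<Sum>i<n. f' (int_decode i) y) (\<lambda>y. \<Sum>i. f' (int_decode i) y) sequentially"
    using bound sums_summable[OF sums_int_decode[OF summable_M]] by (intro Weierstrass_m_test) auto
  then have unif: "\<forall>\<^sub>F n in sequentially. \<forall>y\<in>S. \<forall>h.
      norm ((\<Sum>i<n. h *\<^sub>R f' (int_decode i) y) - h *\<^sub>R (\<Sum>\<^sub>\<infinity>k. f' k y)) \<le> e * norm h" if "e > 0" for e
  proof (rule eventually_mono[OF uniform_limitD[OF _ that]], safe)
    fix n y and h :: real
    assume "\<forall>y\<in>S. dist (\<Sum>i<n. f' (int_decode i) y) (\<Sum>i. f' (int_decode i) y) < e" "y \<in> S"
    then have "norm ((\<Sum>i<n. f' (int_decode i) y) - (\<Sum>\<^sub>\<infinity>k. f' k y)) \<le> e"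
      by (force simp: dist_norm sums_unique[OF sums_int_decode[OF summable_f']])
    then have "\<bar>h\<bar> * norm ((\<Sum>i<n. f' (int_decode i) y) - (\<Sum>\<^sub>\<infinity>k. f' k y)) \<le> \<bar>h\<bar> * e"
      by (intro mult_left_mono) auto
    then show "norm ((\<Sum>i<n. h *\<^sub>R f' (int_decode i) y) - h *\<^sub>R (\<Sum>\<^sub>\<infinity>k. f' k y)) \<le> e * norm h"
      by (simp add: mult.commute flip: norm_scaleR scaleR_sum_right scaleR_diff_right)
  qed
  obtain g where "\<And>y. y \<in> S \<Longrightarrow> (\<lambda>n. f (int_decode n) y) sums g y"
    and g_deriv: "\<And>y. y \<in> S \<Longrightarrow> (g has_vector_derivative (\<Sum>\<^sub>\<infinity>k. f' k y)) (at y within S)"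
    using has_derivative_series[where f = "\<lambda>n. f (int_decode n)", OF \<open>convex S\<close> _ unif x_in_S
        sums_int_decode[OF summable_f[OF x_in_S]]]
      deriv unfolding has_vector_derivative_def by blast
  then have "(\<Sum>\<^sub>\<infinity>k. f k y) = g y" if "y \<in> S" for y
    using sums_unique2[OF sums_int_decode[OF summable_f[OF that]]] that by simp
  then show ?thesis
    by (rule has_vector_derivative_transform[OF x_in_S _ g_deriv[OF x_in_S]])
qed

section \<open>Convolution\<close>

definition conv :: "('i::ab_group_add \<Rightarrow> complex) \<Rightarrow> ('i \<Rightarrow> complex) \<Rightarrow> 'i \<Rightarrow> complex" where
  "conv a b k = (\<Sum>\<^sub>\<infinity>j. a j * b (k - j))"

lemma summable_on_conv_product:
  fixes a b :: "'i::ab_group_add \<Rightarrow> complex"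
  assumes "a summable_on UNIV" "b summable_on UNIV"
  shows "(\<lambda>(k, j). a j * b (k - j)) summable_on (UNIV \<times> UNIV)"
proof (subst summable_on_swap, simp only: prod.case, rule summable_on_dominated)
  have summable_a: "(\<lambda>j. cmod (a j)) summable_on UNIV"
    and summable_b: "(\<lambda>j. cmod (b j)) summable_on UNIV"
    using assms by (simp_all flip: summable_on_iff_abs_summable_on_complex)
  define S where "S = (\<Sum>\<^sub>\<infinity>k. cmod (b k))"
  show "(\<lambda>(j, k). cmod (a j) * cmod (b (k - j))) summable_on (UNIV \<times> UNIV)"
  proof (rule summable_on_SigmaI)
    fix j
    have "((\<lambda>k. cmod (b (k - j))) has_sum S) UNIV"
      unfolding S_def has_sum_reindex_bij_betw[OF bij_plus_right[of "- j"], of "\<lambda>k. cmod (b k)",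
          simplified]
      by (rule has_sum_infsum[OF summable_b])
    from has_sum_cmult_right[OF this, of "cmod (a j)"]
    show "((\<lambda>k. case (j, k) of (j, k) \<Rightarrow> cmod (a j) * cmod (b (k - j))) has_sum cmod (a j) * S) UNIV"
      by simp
  qed (use summable_a in \<open>auto intro: summable_on_cmult_left\<close>)
qed (auto simp: norm_mult)

lemma summable_on_conv_terms:
  fixes a b :: "'i::ab_group_add \<Rightarrow> complex"
  assumes "a summable_on UNIV" "b summable_on UNIV"
  shows "(\<lambda>j. a j * b (k - j)) summable_on UNIV"
  using summable_on_SigmaD1[OF summable_on_conv_product[OF assms]] by simp

lemma summable_on_conv:
  assumes "a summable_on UNIV" "b summable_on UNIV"
  shows "conv a b summable_on UNIV"
  unfolding conv_def by (rule summable_on_Sigma_banach[OF summable_on_conv_product[OF assms]])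

lemma conv_diff_left:
  assumes "a summable_on UNIV" "a' summable_on UNIV" "b summable_on UNIV"
  shows "conv (\<lambda>j. a j - a' j) b k = conv a b k - conv a' b k"
  using summable_on_conv_terms[OF assms(1,3)] summable_on_conv_terms[OF assms(2,3)]
  by (simp add: conv_def left_diff_distrib infsum_diff)

lemma conv_diff_right:
  assumes "a summable_on UNIV" "b summable_on UNIV" "b' summable_on UNIV"
  shows "conv a (\<lambda>j. b j - b' j) k = conv a b k - conv a b' k"
  using summable_on_conv_terms[OF assms(1,2)] summable_on_conv_terms[OF assms(1,3)]
  by (simp add: conv_def right_diff_distrib infsum_diff)

section \<open>Fourier series\<close>

definition fourier_series :: "(int \<Rightarrow> complex) \<Rightarrow> real \<Rightarrow> complex" where
  "fourier_series a x = (\<Sum>\<^sub>\<infinity>k. a k * cis (of_int k * x))"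

lemma summable_on_fourier_series:
  assumes "a summable_on UNIV"
  shows "(\<lambda>k. a k * cis (of_int k * x)) summable_on UNIV"
  using assms unfolding summable_on_iff_abs_summable_on_complex by (simp add: norm_mult)

lemma norm_fourier_series_le:
  assumes "M summable_on UNIV" "\<And>k. cmod (a k) \<le> M k"
  shows "cmod (fourier_series a x) \<le> (\<Sum>\<^sub>\<infinity>k. M k)"
  unfolding fourier_series_def using assms by (intro norm_infsum_dominated) (auto simp: norm_mult)

lemma fourier_series_add:
  assumes "a summable_on UNIV" "b summable_on UNIV"
  shows "fourier_series (\<lambda>k. a k + b k) x = fourier_series a x + fourier_series b x"
  using assms unfolding fourier_series_def
  by (simp add: distrib_right infsum_add summable_on_fourier_series)

lemma fourier_series_cmult: "fourier_series (\<lambda>k. c * a k) x = c * fourier_series a x"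
  by (simp add: fourier_series_def infsum_cmult_right' mult.assoc)

lemma fourier_series_periodic: "fourier_series a (x + 2 * pi) = fourier_series a x"
proof -
  have "cis (of_int k * (x + 2 * pi)) = cis (of_int k * x)" for k
    using cis_mult[of "of_int k * x" "2 * pi * of_int k"] cis_multiple_2pi[of "of_int k"]
    by (simp add: algebra_simps)
  then show ?thesis
    by (simp add: fourier_series_def)
qed

lemma continuous_on_fourier_series:
  assumes "a summable_on UNIV"
  shows "continuous_on S (fourier_series a)"
  unfolding fourier_series_def
  using assms unfolding summable_on_iff_abs_summable_on_complex
  by (rule continuous_on_infsum_dominated[rotated]) (auto intro!: continuous_intros simp: norm_mult)

lemma cnj_fourier_series: "cnj (fourier_series a x) = fourier_series (\<lambda>k. cnj (a (- k))) x"
proof -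
  have "cnj (fourier_series a x) = (\<Sum>\<^sub>\<infinity>k. cnj (a k) * cis (of_int (- k) * x))"
    by (simp add: fourier_series_def cis_cnj flip: infsum_cnj)
  also have "\<dots> = (\<Sum>\<^sub>\<infinity>k. cnj (a (0 - k)) * cis (of_int (- (0 - k)) * x))"
    by (rule infsum_diff_left[symmetric])
  finally show ?thesis
    by (simp add: fourier_series_def)
qed

lemma fourier_series_real:
  assumes "\<And>k. a (- k) = cnj (a k)"
  shows "fourier_series a x = of_real (Re (fourier_series a x))"
  using cnj_fourier_series[of a x] by (simp add: assms complex_eq_iff)

lemma fourier_series_conv:
  assumes summable_a: "a summable_on UNIV" and summable_b: "b summable_on UNIV"
  shows "fourier_series (conv a b) x = fourier_series a x * fourier_series b x"
proof -
  define A B where "A k = a k * cis (of_int k * x)" and "B k = b k * cis (of_int k * x)" for k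
  have summable_AB: "A summable_on UNIV" "B summable_on UNIV"
    unfolding A_def B_def by (intro summable_on_fourier_series summable_a summable_b)+
  have "A j * B (k - j) = a j * b (k - j) * cis (of_int k * x)" for j k
    by (simp add: A_def B_def cis_mult algebra_simps)
  then have "fourier_series (conv a b) x = (\<Sum>\<^sub>\<infinity>k. \<Sum>\<^sub>\<infinity>j. A j * B (k - j))"
    by (simp add: fourier_series_def conv_def infsum_cmult_left')
  also have "\<dots> = (\<Sum>\<^sub>\<infinity>j. A j * (\<Sum>\<^sub>\<infinity>k. B (k - j)))"
    using infsum_swap_banach[OF summable_on_conv_product[OF summable_AB]]
    by (simp add: infsum_cmult_right')
  also have "\<dots> = (\<Sum>\<^sub>\<infinity>j. A j * (\<Sum>\<^sub>\<infinity>k. B k))"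
    using infsum_reindex_bij_betw[OF bij_plus_right, of B "- j" for j] by simp
  finally show ?thesis
    by (simp add: infsum_cmult_left' A_def B_def fourier_series_def)
qed

lemma fourier_series_has_vector_derivative:
  assumes summable_a: "a summable_on UNIV" and summable_deriv: "(\<lambda>k. of_int k * a k) summable_on UNIV"
  shows "(fourier_series a has_vector_derivative fourier_series (\<lambda>k. \<i> * of_int k * a k) x) (at x)"
proof -
  have "((\<lambda>x. \<Sum>\<^sub>\<infinity>k. a k * cis (of_int k * x)) has_vector_derivative
      (\<Sum>\<^sub>\<infinity>k. \<i> * of_int k * a k * cis (of_int k * x))) (at x within UNIV)"
  proof (rule has_vector_derivative_infsum_int)
    show "((\<lambda>x. a k * cis (of_int k * x)) has_vector_derivative
        \<i> * of_int k * a k * cis (of_int k * x)) (at x within UNIV)"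
      for k x
      by (auto intro!: derivative_eq_intros has_vector_derivative_real_field
          simp: cis_conv_exp scaleR_conv_of_real mult_ac)
    show "(\<lambda>k. cmod (of_int k * a k)) summable_on UNIV"
      using summable_deriv by (simp flip: summable_on_iff_abs_summable_on_complex)
  qed (auto simp: norm_mult summable_on_fourier_series summable_a)
  then show ?thesis
    by (simp add: fourier_series_def[abs_def])
qed

section \<open>Fourier coefficients\<close>

lemma integral_cis_int: "integral {-pi..pi} (\<lambda>x. cis (of_int n * x)) =
  (if n = 0 then of_real (2 * pi) else 0)"
proof (cases "n = 0")
  case False
  have "((\<lambda>x. cis (of_int n * x) / (\<i> * of_int n)) has_vector_derivative cis (of_int n * x))
      (at x within {-pi..pi})" for x
    using False
    by (auto intro!: derivative_eq_intros has_vector_derivative_real_field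
          simp: cis_conv_exp scaleR_conv_of_real mult_ac)
  then have "((\<lambda>x. cis (of_int n * x)) has_integral
     cis (of_int n * pi) / (\<i> * of_int n) - cis (of_int n * (-pi)) / (\<i> * of_int n)) {-pi..pi}"
    by (intro fundamental_theorem_of_calculus) auto
  moreover have "cis (of_int n * pi) = cis (of_int n * (-pi))"
    using sin_integer_2pi[of "of_int n"] sin_zero_iff_int2[of "of_int n * pi"]
    by (simp add: complex_eq_iff)
  ultimately show ?thesis
    using False by (simp add: integral_unique)
qed (simp add: scaleR_conv_of_real)

lemma fourier_coeff_eq_of_fourier_series:
  assumes summable_a: "a summable_on UNIV" and g_eq: "\<And>x. of_real (g x) = fourier_series a x"
  shows "fourier_coeff g m = a m"
proof -
  define G where "G k x = a k * cis (of_int (k - m) * x)" for k x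
  have "of_real (g x) * cis (- (of_int m * x)) = (\<Sum>\<^sub>\<infinity>k. G k x)" for x
    unfolding g_eq fourier_series_def infsum_cmult_left'[symmetric] G_def
    by (simp add: mult.assoc cis_mult algebra_simps)
  moreover have "((\<lambda>k. integral {-pi..pi} (G k)) has_sum integral {-pi..pi} (\<lambda>x. \<Sum>\<^sub>\<infinity>k. G k x)) UNIV"
    using summable_a unfolding G_def summable_on_iff_abs_summable_on_complex
    by (intro has_sum_integral_dominated) (auto intro!: continuous_intros simp: norm_mult)
  moreover have "integral {-pi..pi} (G k) = (if k = m then a m * of_real (2 * pi) else 0)" for k
    using integral_cis_int[of "k - m"] unfolding G_def by (simp del: of_int_diff)
  then have "((\<lambda>k. integral {-pi..pi} (G k)) has_sum (a m * of_real (2 * pi))) UNIV"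
    by (intro has_sum_finite_neutralI[of "{m}"]) auto
  ultimately have "integral {-pi..pi} (\<lambda>x. of_real (g x) * cis (- (of_int m * x))) =
    a m * of_real (2 * pi)"
    using has_sum_unique by (simp only:) blast
  then show ?thesis
    by (simp add: fourier_coeff_def)
qed

lemma Lambda_fourier_series:
  assumes "a summable_on UNIV" "\<And>x. of_real (g x) = fourier_series a x"
  shows "Lambda g x = Re (fourier_series (\<lambda>k. of_int \<bar>k\<bar> * a k) x)"
  by (simp add: Lambda_def fourier_series_def fourier_coeff_eq_of_fourier_series[OF assms])

lemma fourier_coeff_integrable:
  assumes "continuous_on {-pi..pi} f"
  shows "(\<lambda>x. complex_of_real (f x) * cis (- (of_int k * x))) integrable_on {-pi..pi}"
  by (intro integrable_continuous_real continuous_intros assms)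

lemma fourier_coeff_uminus_index: "fourier_coeff f (- k) = cnj (fourier_coeff f k)"
  by (simp add: fourier_coeff_def integral_cnj cis_cnj)

lemma fourier_coeff_reflect: "fourier_coeff (\<lambda>x. f (- x)) k = fourier_coeff f (- k)"
  using Henstock_Kurzweil_Integration.integral_reflect_real
    [of pi "- pi" "\<lambda>x. complex_of_real (f x) * cis (of_int k * x)"]
  by (simp add: fourier_coeff_def)

lemma fourier_coeff_cmult: "fourier_coeff (\<lambda>x. c * f x) k = of_real c * fourier_coeff f k"
  by (simp add: fourier_coeff_def mult.assoc)

lemma fourier_coeff_add:
  assumes "continuous_on {-pi..pi} f" "continuous_on {-pi..pi} g"
  shows "fourier_coeff (\<lambda>x. f x + g x) k = fourier_coeff f k + fourier_coeff g k"
  using integral_add[OF fourier_coeff_integrable[OF assms(1)] fourier_coeff_integrable[OF assms(2)]]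
  by (simp add: fourier_coeff_def distrib_right add_divide_distrib)

lemma fourier_coeff_mult_cos:
  assumes "continuous_on {-pi..pi} f"
  shows "fourier_coeff (\<lambda>x. f x * cos x) k = (fourier_coeff f (k - 1) + fourier_coeff f (k + 1)) / 2"
proof -
  have "of_real (f x * cos x) * cis (- (of_int k * x)) =
      (of_real (f x) * cis (- (of_int (k - 1) * x)) +
       of_real (f x) * cis (- (of_int (k + 1) * x))) / 2" for x
    by (simp add: complex_eq_iff cos_add sin_add cos_diff sin_diff algebra_simps)
  then show ?thesis
    using integral_add[OF fourier_coeff_integrable[OF assms]
        fourier_coeff_integrable[OF assms], of "k - 1" "k + 1"]
    by (simp only: fourier_coeff_def integral_divide) (simp add: add_divide_distrib)
qed

lemma fourier_coeff_mult_sin: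
  assumes "continuous_on {-pi..pi} f"
  shows "fourier_coeff (\<lambda>x. f x * sin x) k =
      (fourier_coeff f (k - 1) - fourier_coeff f (k + 1)) / (2 * \<i>)"
proof -
  have "of_real (f x * sin x) * cis (- (of_int k * x)) =
      (of_real (f x) * cis (- (of_int (k - 1) * x)) -
       of_real (f x) * cis (- (of_int (k + 1) * x))) / (2 * \<i>)" for x
    by (simp add: complex_eq_iff Re_divide Im_divide cos_add sin_add cos_diff sin_diff algebra_simps)
  then show ?thesis
    using integral_diff[OF fourier_coeff_integrable[OF assms]
        fourier_coeff_integrable[OF assms], of "k - 1" "k + 1"]
    by (simp only: fourier_coeff_def integral_divide) (simp add: diff_divide_distrib right_diff_distrib)
qed


lemma continuous_on_polynomial_cis:
  assumes "real_polynomial_function p"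
  shows "continuous_on S (\<lambda>x. p (cis x))"
proof (rule continuous_on_compose2[of UNIV p])
  show "continuous_on UNIV p"
    using assms by (simp add: continuous_on_polymonial_function real_polynomial_function_eq)
qed (auto intro!: continuous_intros)

text \<open>The continuous functions all of whose Fourier coefficients vanish are closed under
  multiplication by the coordinates of \<open>cis x\<close>, hence by every polynomial in them.\<close>
lemma fourier_coeff_mult_polynomial_zero:
  assumes "real_polynomial_function p" "continuous_on {-pi..pi} f" "\<And>k. fourier_coeff f k = 0"
  shows "fourier_coeff (\<lambda>x. f x * p (cis x)) k = 0"
  using assms
proof (induction p arbitrary: f k)
  case (linear L)
  interpret bounded_linear L by fact
  have "L (cis x) = L 1 * cos x + L \<i> * sin x" for x
  proof -
    have "cis x = cos x *\<^sub>R 1 + sin x *\<^sub>R \<i>"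
      by (simp add: complex_eq_iff)
    then show ?thesis
      by (simp only: add scaleR) (simp add: mult.commute)
  qed
  then have "fourier_coeff (\<lambda>x. f x * L (cis x)) k =
      fourier_coeff (\<lambda>x. L 1 * (f x * cos x) + L \<i> * (f x * sin x)) k"
    by (simp add: algebra_simps)
  also have "\<dots> = 0"
    using linear.prems
    by (subst fourier_coeff_add)
       (auto intro!: continuous_intros
           simp: fourier_coeff_cmult fourier_coeff_mult_cos fourier_coeff_mult_sin)
  finally show ?case .
next
  case (const c)
  then show ?case
    using fourier_coeff_cmult[of c f k] by (simp add: mult.commute)
next
  case (add p q)
  have "continuous_on {-pi..pi} (\<lambda>x. f x * p (cis x))" "continuous_on {-pi..pi} (\<lambda>x. f x * q (cis x))"
    using add by (auto intro: continuous_on_mult continuous_on_polynomial_cis)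
  then show ?case
    using add by (simp add: distrib_left fourier_coeff_add)
next
  case (mult p q)
  have "continuous_on {-pi..pi} (\<lambda>x. f x * p (cis x))"
    using mult by (auto intro: continuous_on_mult continuous_on_polynomial_cis)
  then show ?case
    using mult by (simp add: mult.assoc[symmetric])
qed

lemma periodic2pi_eq_of_cis_eq:
  assumes "periodic2pi f" "cis x = cis y"
  shows "f x = f y"
proof -
  interpret periodic_fun_simple f "2 * pi"
    using assms(1) by unfold_locales (simp add: periodic2pi_def)
  obtain n :: int where "x = y + 2 * pi * of_int n"
    using assms(2) sin_cos_eq_iff[of x y] by (auto simp: complex_eq_iff)
  then show ?thesis
    using plus_of_int[of y n] by (simp add: mult.commute)
qed

lemma periodic2pi_Arg_cis: "periodic2pi f \<Longrightarrow> f (Arg (cis x)) = f x"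
  by (rule periodic2pi_eq_of_cis_eq) (simp_all add: cis_Arg)

lemma continuous_on_periodic2pi_Arg:
  assumes "periodic2pi f" "continuous_on UNIV f"
  shows "continuous_on (- {0}) (\<lambda>z. f (Arg z))"
proof (intro continuous_at_imp_continuous_on ballI)
  fix z :: complex assume "z \<in> - {0}"
  have isCont_f: "isCont f x" for x
    using assms(2) by (simp add: continuous_on_eq_continuous_at)
  show "isCont (\<lambda>z. f (Arg z)) z"
  proof (cases "z \<in> \<real>\<^sub>\<le>\<^sub>0")
    case False
    then show ?thesis
      using isCont_o2[OF continuous_at_Arg isCont_f] by simp
  next
    case True
    have "\<forall>\<^sub>F w in nhds z. f (Arg w) = f (Arg (- w) + pi)"
    proof (rule eventually_mono[OF t1_space_nhds[of z 0]])
      show "f (Arg w) = f (Arg (- w) + pi)" if "w \<noteq> 0" for w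
        using that by (intro periodic2pi_eq_of_cis_eq[OF assms(1)])
           (simp add: cis_Arg sgn_minus flip: minus_cis)
    qed (use \<open>z \<in> - {0}\<close> in simp)
    moreover have "isCont (\<lambda>w. f (Arg (- w) + pi)) z"
    proof (rule isCont_o2[OF _ isCont_f])
      have "- z \<notin> \<real>\<^sub>\<le>\<^sub>0"
        using True \<open>z \<in> - {0}\<close> by (auto simp: complex_nonpos_Reals_iff complex_eq_iff)
      then show "isCont (\<lambda>w. Arg (- w) + pi) z"
        by (intro continuous_intros isCont_o2[OF _ continuous_at_Arg])
    qed
    ultimately show ?thesis
      by (simp add: isCont_cong)
  qed
qed

lemma fourier_coeffs_zero_imp_integral_square_le:
  assumes per: "periodic2pi f" and cont: "continuous_on UNIV f"
    and zero: "\<And>k. fourier_coeff f k = 0" and "0 < e"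
  shows "integral {-pi..pi} (\<lambda>x. (f x)^2) \<le> 2 * pi * e^2"
proof -
  have cont_f: "continuous_on S f" for S
    using cont continuous_on_subset by blast
  have "continuous_on (sphere 0 1) (\<lambda>z. f (Arg z))"
    by (rule continuous_on_subset[OF continuous_on_periodic2pi_Arg[OF per cont]]) auto
  then obtain p where p_approx: "real_polynomial_function p"
    "\<And>z. z \<in> sphere 0 1 \<Longrightarrow> \<bar>f (Arg z) - p z\<bar> < e"
    using Stone_Weierstrass_real_polynomial_function[of "sphere 0 1" "\<lambda>z. f (Arg z)"] \<open>0 < e\<close> by auto
  define q where "q x = p (cis x)" for x
  have cont_q: "continuous_on S q" for S
    unfolding q_def by (rule continuous_on_polynomial_cis[OF p_approx(1)])
  have orthogonal: "integral {-pi..pi} (\<lambda>x. f x * q x) = 0"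
  proof -
    have "integral {-pi..pi} (\<lambda>x. complex_of_real (f x * q x)) = 0"
      using fourier_coeff_mult_polynomial_zero[OF p_approx(1) cont_f zero, of 0]
      by (simp add: fourier_coeff_def q_def)
    moreover have "((\<lambda>x. complex_of_real (f x * q x)) has_integral
        of_real (integral {-pi..pi} (\<lambda>x. f x * q x))) {-pi..pi}"
      by (intro has_integral_of_real integrable_integral integrable_continuous_real
            continuous_intros cont_f cont_q)
    ultimately show ?thesis
      by (metis integral_unique of_real_eq_0_iff)
  qed
  have "integral {-pi..pi} (\<lambda>x. (f x)^2) \<le> integral {-pi..pi} (\<lambda>x. 2 * (f x * q x) + (f x - q x)^2)"
    by (intro integral_le integrable_continuous_real continuous_intros cont_f cont_q)
       (simp add: power2_eq_square algebra_simps)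
  also have "\<dots> = integral {-pi..pi} (\<lambda>x. (f x - q x)^2)"
    by (subst integral_add)
       (auto intro!: integrable_continuous_real continuous_intros cont_f cont_q simp: orthogonal)
  also have "\<dots> \<le> integral {-pi..pi} (\<lambda>x. e^2)"
  proof (rule integral_le)
    show "(f x - q x)^2 \<le> e^2" for x
      using p_approx(2)[of "cis x"]
      by (intro abs_le_square_iff[THEN iffD1]) (simp add: q_def periodic2pi_Arg_cis[OF per])
  qed (auto intro!: integrable_continuous_real continuous_intros cont_f cont_q)
  finally show ?thesis by simp
qed

lemma fourier_coeffs_zero_imp_zero:
  assumes per: "periodic2pi f" and cont: "continuous_on UNIV f" and "\<And>k. fourier_coeff f k = 0"
  shows "f x = 0"
proof -
  have cont_f: "continuous_on S f" for S
    using cont continuous_on_subset by blast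
  have "integral {-pi..pi} (\<lambda>y. (f y)^2) \<le> 0 + d" if "d > 0" for d
    using fourier_coeffs_zero_imp_integral_square_le[OF assms, of "sqrt (d / (2 * pi))"] that by simp
  then have "integral {-pi..pi} (\<lambda>y. (f y)^2) \<le> 0"
    by (rule field_le_epsilon)
  moreover have "0 \<le> integral {-pi..pi} (\<lambda>y. (f y)^2)"
    by (intro integral_nonneg integrable_continuous_real continuous_intros cont_f) auto
  ultimately have "\<forall>y\<in>{-pi..pi}. (f y)^2 = 0"
    by (subst integral_eq_0_iff[symmetric]) (auto intro!: continuous_intros cont_f)
  then have "f (Arg (cis x)) = 0"
    using Arg_bounded[of "cis x"] by (simp add: less_imp_le)
  then show ?thesis
    by (simp add: periodic2pi_Arg_cis[OF per])
qed

lemma fourier_inversion: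
  assumes per: "periodic2pi f" and cont: "continuous_on UNIV f"
    and summable: "fourier_coeff f summable_on UNIV"
  shows "of_real (f x) = fourier_series (fourier_coeff f) x"
proof -
  define h where "h y = Re (fourier_series (fourier_coeff f) y)" for y
  have h_eq: "of_real (h y) = fourier_series (fourier_coeff f) y" for y
    unfolding h_def by (rule fourier_series_real[symmetric]) (rule fourier_coeff_uminus_index)
  have cont_h: "continuous_on S h" and cont_f: "continuous_on S f" for S
    using continuous_on_fourier_series[OF summable] continuous_on_subset[OF cont]
    by (auto simp: h_def[abs_def] intro: continuous_on_Re)
  have "f x + - 1 * h x = 0"
  proof (rule fourier_coeffs_zero_imp_zero[where f = "\<lambda>x. f x + - 1 * h x"])
    show "periodic2pi (\<lambda>x. f x + - 1 * h x)"
      using per by (simp add: periodic2pi_def h_def fourier_series_periodic)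
    show "continuous_on UNIV (\<lambda>x. f x + - 1 * h x)"
      by (intro continuous_intros cont_f cont_h)
    show "fourier_coeff (\<lambda>x. f x + - 1 * h x) k = 0" for k
      using fourier_coeff_add[OF cont_f continuous_on_mult_left[OF cont_h, where c = "- 1"], of k]
      by (simp only: fourier_coeff_cmult fourier_coeff_eq_of_fourier_series[OF summable h_eq]) simp
  qed
  then show ?thesis
    using h_eq[of x] by simp
qed

section \<open>Exponentially weighted sequences\<close>

definition exp_weight :: "real \<Rightarrow> int \<Rightarrow> real" where
  "exp_weight c k = exp (- (c * \<bar>of_int k\<bar>)) / (1 + \<bar>of_int k\<bar>)^2"

definition weight_bounded :: "real \<Rightarrow> real \<Rightarrow> (int \<Rightarrow> complex) \<Rightarrow> bool" where
  "weight_bounded c A a \<longleftrightarrow> (\<forall>k. cmod (a k) \<le> A * exp_weight c k)"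

definition conv_const :: real where
  "conv_const = 4 * (\<Sum>\<^sub>\<infinity>k. exp_weight 0 k)"

lemma exp_weight_pos [simp]: "0 < exp_weight c k"
  by (simp add: exp_weight_def add_pos_nonneg)

lemma exp_weight_nonneg [simp]: "0 \<le> exp_weight c k"
  by (simp add: less_imp_le)

lemma exp_weight_antimono: "c \<le> c' \<Longrightarrow> exp_weight c' k \<le> exp_weight c k"
  by (simp add: exp_weight_def divide_right_mono mult_right_mono)

lemma summable_exp_weight_0: "exp_weight 0 summable_on UNIV"
proof -
  have "summable (\<lambda>n. inverse (real (Suc n) ^ 2))"
    by (subst summable_Suc_iff[of "\<lambda>n. inverse (real n ^ 2)"]) (simp add: inverse_power_summable)
  then have "(\<lambda>n. 1 / (1 + real n)^2) summable_on UNIV"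
    by (intro norm_summable_imp_summable_on) (simp add: inverse_eq_divide add.commute)
  from summable_on_int_abs[OF this] show ?thesis
    by (simp add: exp_weight_def[abs_def])
qed

lemma conv_const_ge_1: "1 \<le> conv_const"
  using finite_sum_le_infsum[OF summable_exp_weight_0, of "{0}"]
  by (simp add: conv_const_def exp_weight_def[of 0 0])

lemma exp_weight_mult_le:
  assumes "0 \<le> c"
  shows "exp_weight c j * exp_weight c (k - j) \<le>
      2 * exp_weight c k * (exp_weight 0 j + exp_weight 0 (k - j))"
proof -
  define x y z where "x = 1 + \<bar>real_of_int j\<bar>" and "y = 1 + \<bar>real_of_int (k - j)\<bar>"
    and "z = 1 + \<bar>real_of_int k\<bar>"
  have pos: "x > 0" "y > 0" "z > 0" and "z \<le> x + y"
    by (auto simp: x_def y_def z_def)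
  then have "z^2 \<le> (x + y)^2"
    by (intro power_mono) auto
  also have "\<dots> \<le> 2 * (x^2 + y^2)"
    using sum_squares_bound[of x y] by (simp add: power2_sum)
  finally have denominators: "1 / (x^2 * y^2) \<le> 2 * (1 / z^2) * (1 / x^2 + 1 / y^2)"
    using pos by (simp add: field_simps)
  have "c * \<bar>of_int k\<bar> \<le> c * (\<bar>of_int j\<bar> + \<bar>of_int (k - j)\<bar>)"
    using assms by (intro mult_left_mono) auto
  then have "exp (- (c * \<bar>of_int j\<bar>)) * exp (- (c * \<bar>of_int (k - j)\<bar>)) \<le> exp (- (c * \<bar>real_of_int k\<bar>))"
    by (simp add: exp_add[symmetric] algebra_simps)
  then have "exp (- (c * \<bar>of_int j\<bar>)) * exp (- (c * \<bar>of_int (k - j)\<bar>)) * (1 / (x^2 * y^2))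
      \<le> exp (- (c * \<bar>real_of_int k\<bar>)) * (2 * (1 / z^2) * (1 / x^2 + 1 / y^2))"
    using denominators by (intro mult_mono) auto
  then show ?thesis
    by (simp add: exp_weight_def x_def y_def z_def algebra_simps)
qed

lemma weight_bounded_nonneg:
  assumes "weight_bounded c A a"
  shows "0 \<le> A"
proof -
  have "0 \<le> A * exp_weight c 0"
    using assms norm_ge_zero order_trans unfolding weight_bounded_def by blast
  then show ?thesis
    using exp_weight_pos[of c 0] by (auto simp: zero_le_mult_iff simp del: exp_weight_pos)
qed

lemma weight_bounded_mono:
  assumes "weight_bounded c A a" "A \<le> B" "c' \<le> c"
  shows "weight_bounded c' B a"
  unfolding weight_bounded_def
proof
  fix k
  have "cmod (a k) \<le> A * exp_weight c k"
    using assms(1) by (simp add: weight_bounded_def)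
  also have "\<dots> \<le> B * exp_weight c' k"
    using assms weight_bounded_nonneg[OF assms(1)] by (intro mult_mono exp_weight_antimono) auto
  finally show "cmod (a k) \<le> B * exp_weight c' k" .
qed

lemma weight_bounded_add:
  assumes "weight_bounded c A a" "weight_bounded c B b"
  shows "weight_bounded c (A + B) (\<lambda>k. a k + b k)"
  using assms norm_triangle_mono unfolding weight_bounded_def distrib_right by blast

lemma weight_bounded_cmult:
  assumes "weight_bounded c A a"
  shows "weight_bounded c (cmod r * A) (\<lambda>k. r * a k)"
  using assms by (simp add: weight_bounded_def norm_mult mult.assoc mult_left_mono)

lemma weight_bounded_imp_summable:
  assumes "weight_bounded c A a" "0 \<le> c"
  shows "a summable_on UNIV"
  using weight_bounded_mono[OF assms(1) order.refl assms(2)] unfolding weight_bounded_def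
  by (intro summable_on_dominated[OF summable_on_cmult_right[OF summable_exp_weight_0]]) auto

lemma norm_fourier_series_weight_bounded:
  assumes "weight_bounded 0 A a"
  shows "cmod (fourier_series a x) \<le> A * conv_const / 4"
  using norm_fourier_series_le[OF summable_on_cmult_right[OF summable_exp_weight_0], of a A] assms
  by (simp add: weight_bounded_def conv_const_def infsum_cmult_right')

lemma conv_term_weight_bounded:
  assumes "0 \<le> c" and a_bound: "weight_bounded c A a" and b_bound: "weight_bounded c B b"
  shows "cmod (a j * b (k - j)) \<le> 2 * A * B * exp_weight c k * (exp_weight 0 j + exp_weight 0 (k - j))"
proof -
  note nonneg = weight_bounded_nonneg[OF a_bound] weight_bounded_nonneg[OF b_bound]
  have "cmod (a j * b (k - j)) \<le> (A * exp_weight c j) * (B * exp_weight c (k - j))"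
    unfolding norm_mult using a_bound b_bound nonneg
    by (intro mult_mono) (auto simp: weight_bounded_def)
  also have "\<dots> = A * B * (exp_weight c j * exp_weight c (k - j))" by simp
  also have "\<dots> \<le> A * B * (2 * exp_weight c k * (exp_weight 0 j + exp_weight 0 (k - j)))"
    using nonneg exp_weight_mult_le[OF \<open>0 \<le> c\<close>] by (intro mult_left_mono) auto
  finally show ?thesis by (simp add: mult_ac)
qed

lemma has_sum_conv_majorant:
  "((\<lambda>j. C * (exp_weight 0 j + exp_weight 0 (k - j))) has_sum C * (conv_const / 2)) UNIV"
proof -
  have "(exp_weight 0 has_sum conv_const / 4) UNIV"
    using has_sum_infsum[OF summable_exp_weight_0] by (simp add: conv_const_def)
  moreover from this have "((\<lambda>j. exp_weight 0 (k - j)) has_sum conv_const / 4) UNIV"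
    by (subst has_sum_reindex_bij_betw[OF bij_diff_left])
  ultimately show ?thesis
    using has_sum_cmult_right[OF has_sum_add] by fastforce
qed

lemma weight_bounded_conv:
  assumes "0 \<le> c" "weight_bounded c A a" "weight_bounded c B b"
  shows "weight_bounded c (conv_const * A * B) (conv a b)"
  unfolding weight_bounded_def conv_def
proof
  fix k
  have "cmod (\<Sum>\<^sub>\<infinity>j. a j * b (k - j)) \<le> 2 * A * B * exp_weight c k * (conv_const / 2)"
    using norm_infsum_dominated[OF has_sum_imp_summable[OF has_sum_conv_majorant]
        conv_term_weight_bounded[OF assms]]
    by (simp add: infsumI[OF has_sum_conv_majorant])
  then show "cmod (\<Sum>\<^sub>\<infinity>j. a j * b (k - j)) \<le> conv_const * A * B * exp_weight c k"
    by (simp add: mult_ac)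
qed

lemma weight_bounded_conv_diff:
  assumes "0 \<le> c"
    and a_bounds: "weight_bounded c A a" "weight_bounded c A a'" "weight_bounded c D (\<lambda>k. a k - a' k)"
    and b_bounds: "weight_bounded c B b" "weight_bounded c B b'" "weight_bounded c E (\<lambda>k. b k - b' k)"
  shows "weight_bounded c (conv_const * D * B + conv_const * A * E) (\<lambda>k. conv a b k - conv a' b' k)"
proof -
  note summable = weight_bounded_imp_summable[OF _ \<open>0 \<le> c\<close>]
  have "conv a b k - conv a' b' k = conv (\<lambda>k. a k - a' k) b k + conv a' (\<lambda>k. b k - b' k) k" for k
    using a_bounds b_bounds by (simp add: conv_diff_left conv_diff_right summable)
  then show ?thesis
    using weight_bounded_add[OF weight_bounded_conv[OF \<open>0 \<le> c\<close> a_bounds(3) b_bounds(1)]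
        weight_bounded_conv[OF \<open>0 \<le> c\<close> a_bounds(2) b_bounds(3)]]
    by simp
qed

lemma continuous_on_conv:
  assumes "\<And>k. continuous_on T (\<lambda>t. a t k)" "\<And>t. t \<in> T \<Longrightarrow> weight_bounded 0 A (a t)"
    and "\<And>k. continuous_on T (\<lambda>t. b t k)" "\<And>t. t \<in> T \<Longrightarrow> weight_bounded 0 B (b t)"
  shows "continuous_on T (\<lambda>t. conv (a t) (b t) k)"
  unfolding conv_def
  by (rule continuous_on_infsum_dominated[OF _ has_sum_imp_summable[OF has_sum_conv_majorant]])
     (use assms in \<open>auto intro: continuous_on_mult conv_term_weight_bounded[of 0 A _ B, simplified]\<close>)

subsection \<open>Quotients as solutions of linear equations\<close>

text \<open>If \<open>v\<close> and \<open>w\<close> are the sums of the Fourier series of \<open>a\<close> and \<open>q\<close>, then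
  \<open>q = geometric_map \<sigma> \<tau> a q\<close> says \<open>w = \<sigma> v^2 + \<tau> v^2 w\<close>, that is \<open>w = \<sigma> v^2 / (1 - \<tau> v^2)\<close>.\<close>
definition geometric_map ::
  "complex \<Rightarrow> complex \<Rightarrow> (int \<Rightarrow> complex) \<Rightarrow> (int \<Rightarrow> complex) \<Rightarrow> int \<Rightarrow> complex" where
  "geometric_map \<sigma> \<tau> a q k = \<sigma> * conv a a k + \<tau> * conv (conv a a) q k"

lemma weight_bounded_geometric_map_diff:
  assumes "0 \<le> c"
    and "weight_bounded c A a" "weight_bounded c A a'" "weight_bounded c D (\<lambda>k. a k - a' k)"
    and "weight_bounded c B q" "weight_bounded c B q'" "weight_bounded c E (\<lambda>k. q k - q' k)"
  shows "weight_bounded c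
    (cmod \<sigma> * (conv_const * D * A + conv_const * A * D) +
     cmod \<tau> * (conv_const * (conv_const * D * A + conv_const * A * D) * B +
       conv_const * (conv_const * A * A) * E))
    (\<lambda>k. geometric_map \<sigma> \<tau> a q k - geometric_map \<sigma> \<tau> a' q' k)"
proof -
  have "geometric_map \<sigma> \<tau> a q k - geometric_map \<sigma> \<tau> a' q' k =
      \<sigma> * (conv a a k - conv a' a' k) + \<tau> * (conv (conv a a) q k - conv (conv a' a') q' k)" for k
    by (simp add: geometric_map_def algebra_simps)
  then show ?thesis
    by (simp only:) (intro weight_bounded_add weight_bounded_cmult weight_bounded_conv_diff
          weight_bounded_conv assms)
qed

lemma continuous_on_geometric_map:
  assumes a_assms: "\<And>k. continuous_on T (\<lambda>t. a t k)" "\<And>t. t \<in> T \<Longrightarrow> weight_bounded 0 A (a t)"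
    and q_assms: "\<And>k. continuous_on T (\<lambda>t. q t k)" "\<And>t. t \<in> T \<Longrightarrow> weight_bounded 0 B (q t)"
  shows "continuous_on T (\<lambda>t. geometric_map \<sigma> \<tau> (a t) (q t) k)"
proof -
  have "continuous_on T (\<lambda>t. conv (a t) (a t) k)" for k
    by (rule continuous_on_conv[OF a_assms a_assms])
  moreover from this have "continuous_on T (\<lambda>t. conv (conv (a t) (a t)) (q t) k)"
    by (rule continuous_on_conv[OF _ weight_bounded_conv[OF order.refl a_assms(2) a_assms(2)] q_assms])
  ultimately show ?thesis
    unfolding geometric_map_def by (intro continuous_intros)
qed

lemma fourier_series_geometric_map_fixed_point:
  assumes summable_a: "a summable_on UNIV" and summable_q: "q summable_on UNIV"
    and fixed: "q = geometric_map \<sigma> \<tau> a q"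
    and nonzero: "1 - \<tau> * (fourier_series a x)^2 \<noteq> 0"
  shows "fourier_series q x = \<sigma> * (fourier_series a x)^2 / (1 - \<tau> * (fourier_series a x)^2)"
proof -
  define v w where "v = fourier_series a x" and "w = fourier_series q x"
  note summable_aa = summable_on_conv[OF summable_a summable_a]
  have "w = fourier_series (\<lambda>k. \<sigma> * conv a a k + \<tau> * conv (conv a a) q k) x"
    unfolding w_def by (subst fixed) (simp add: geometric_map_def[abs_def])
  also have "\<dots> = \<sigma> * v^2 + \<tau> * v^2 * w"
    using summable_a summable_q summable_aa
    by (simp add: fourier_series_add fourier_series_cmult fourier_series_conv summable_on_conv
        summable_on_cmult_right v_def w_def power2_eq_square)
  finally have "w * (1 - \<tau> * v^2) = \<sigma> * v^2"
    by (simp add: algebra_simps)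
  then show ?thesis
    using nonzero by (simp add: nonzero_eq_divide_eq v_def w_def)
qed

subsection \<open>Real functions of definite parity\<close>

text \<open>The Fourier coefficients of even real functions for \<open>p = 1\<close>, of odd ones for \<open>p = - 1\<close>.\<close>
definition fourier_parity :: "complex \<Rightarrow> (int \<Rightarrow> complex) \<Rightarrow> bool" where
  "fourier_parity p a \<longleftrightarrow> (\<forall>k. a (- k) = p * a k \<and> cnj (a k) = p * a k)"

lemma fourier_parity_imp_real:
  "fourier_parity p a \<Longrightarrow> fourier_series a x = of_real (Re (fourier_series a x))"
  by (rule fourier_series_real) (simp add: fourier_parity_def)

lemma fourier_parity_odd_at_zero:
  assumes "fourier_parity (- 1) a"
  shows "a 0 = 0"
proof -
  have "a (- 0) = - 1 * a 0"
    using assms unfolding fourier_parity_def by blast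
  then show ?thesis by simp
qed

lemma fourier_parity_add:
  "fourier_parity p a \<Longrightarrow> fourier_parity p b \<Longrightarrow> fourier_parity p (\<lambda>k. a k + b k)"
  by (simp add: fourier_parity_def distrib_left)

lemma fourier_parity_cmult: "fourier_parity p a \<Longrightarrow> cnj r = r \<Longrightarrow> fourier_parity p (\<lambda>k. r * a k)"
  by (simp add: fourier_parity_def)

lemma fourier_parity_abs: "fourier_parity p a \<Longrightarrow> fourier_parity p (\<lambda>k. of_int \<bar>k\<bar> * a k)"
  by (simp add: fourier_parity_def)

lemma fourier_parity_deriv: "fourier_parity p a \<Longrightarrow> fourier_parity (- p) (\<lambda>k. \<i> * of_int k * a k)"
  by (simp add: fourier_parity_def)

lemma fourier_parity_conv:
  assumes "fourier_parity p a" "fourier_parity q b"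
  shows "fourier_parity (p * q) (conv a b)"
  unfolding fourier_parity_def
proof (intro allI conjI)
  fix k
  have parity_a: "a (- j) = p * a j" "cnj (a j) = p * a j"
    and parity_b: "b (- j) = q * b j" "cnj (b j) = q * b j" for j
    using assms by (auto simp: fourier_parity_def)
  have "conv a b (- k) = (\<Sum>\<^sub>\<infinity>j. a (0 - j) * b (- k - (0 - j)))"
    unfolding conv_def by (rule infsum_diff_left[symmetric])
  also have "\<dots> = (\<Sum>\<^sub>\<infinity>j. (p * q) * (a j * b (k - j)))"
    using parity_b(1)[of "k - j" for j] by (intro infsum_cong) (simp add: parity_a)
  finally show "conv a b (- k) = p * q * conv a b k"
    by (simp add: conv_def infsum_cmult_right')
  have "cnj (conv a b k) = (\<Sum>\<^sub>\<infinity>j. (p * q) * (a j * b (k - j)))"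
    by (simp add: conv_def parity_a parity_b mult_ac flip: infsum_cnj)
  then show "cnj (conv a b k) = p * q * conv a b k"
    by (simp add: conv_def infsum_cmult_right')
qed

lemma fourier_parity_geometric_map:
  assumes "fourier_parity p a" "p * p = 1" "fourier_parity 1 q" "cnj \<sigma> = \<sigma>" "cnj \<tau> = \<tau>"
  shows "fourier_parity 1 (geometric_map \<sigma> \<tau> a q)"
proof -
  have "fourier_parity 1 (conv a a)"
    using fourier_parity_conv[OF assms(1,1)] assms(2) by simp
  then show ?thesis
    unfolding geometric_map_def[abs_def]
    using fourier_parity_conv[of 1 "conv a a" 1 q] assms(3-5)
    by (intro fourier_parity_add fourier_parity_cmult) auto
qed

lemma fourier_parity_fourier_coeff_odd:
  assumes "\<And>x. f (- x) = - f x"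
  shows "fourier_parity (- 1) (fourier_coeff f)"
  using fourier_coeff_reflect[of f] fourier_coeff_cmult[of "- 1" f] assms
  by (simp add: fourier_parity_def fourier_coeff_uminus_index[symmetric])

section \<open>The Duhamel integral\<close>

definition duhamel :: "real \<Rightarrow> 'a::banach \<Rightarrow> (real \<Rightarrow> 'a) \<Rightarrow> real \<Rightarrow> 'a" where
  "duhamel r z N t = exp (- (r * t)) *\<^sub>R (z + integral {0..t} (\<lambda>s. exp (r * s) *\<^sub>R N s))"

lemma duhamel_0 [simp]: "duhamel r z N 0 = z"
  by (simp add: duhamel_def)

lemma duhamel_has_vector_derivative:
  assumes cont: "continuous_on {0..} N" and t_nonneg: "0 \<le> t"
  shows "(duhamel r z N has_vector_derivative N t - r *\<^sub>R duhamel r z N t) (at t within {0..})"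
proof -
  define I where "I t = integral {0..t} (\<lambda>s. exp (r * s) *\<^sub>R N s)" for t
  have "(I has_vector_derivative exp (r * t) *\<^sub>R N t) (at t within {0..t + 1})"
    unfolding I_def
    by (rule integral_has_vector_derivative)
       (use t_nonneg in \<open>auto intro!: continuous_intros continuous_on_subset[OF cont]\<close>)
  moreover have "at t within {0..t + 1} = at t within {0..}"
    by (rule at_within_nhd[of _ "{..<t + 1}"]) auto
  ultimately have I_deriv: "(I has_vector_derivative exp (r * t) *\<^sub>R N t) (at t within {0..})"
    by simp
  have "((\<lambda>t. exp (- (r * t)) *\<^sub>R (z + I t)) has_vector_derivative
      exp (- (r * t)) *\<^sub>R (exp (r * t) *\<^sub>R N t) + (- r * exp (- (r * t))) *\<^sub>R (z + I t))
      (at t within {0..})"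
    by (auto intro!: derivative_eq_intros I_deriv)
  then show ?thesis
    by (simp add: duhamel_def[abs_def] I_def exp_minus)
qed

lemma continuous_on_duhamel:
  assumes "continuous_on {0..} N"
  shows "continuous_on {0..} (duhamel r z N)"
  by (rule continuous_on_vector_derivative) (rule duhamel_has_vector_derivative[OF assms], simp)

lemma duhamel_diff:
  assumes "continuous_on {0..t} M" "continuous_on {0..t} N"
  shows "duhamel r z M t - duhamel r z N t = duhamel r 0 (\<lambda>s. M s - N s) t"
proof -
  have "integral {0..t} (\<lambda>s. exp (r * s) *\<^sub>R (M s - N s)) =
      integral {0..t} (\<lambda>s. exp (r * s) *\<^sub>R M s) - integral {0..t} (\<lambda>s. exp (r * s) *\<^sub>R N s)"
    unfolding scaleR_diff_right
    by (intro integral_diff integrable_continuous_real continuous_intros assms)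
  then show ?thesis
    by (simp add: duhamel_def flip: scaleR_diff_right)
qed

lemma duhamel_cong: "(\<And>s. s \<in> {0..t} \<Longrightarrow> M s = N s) \<Longrightarrow> duhamel r z M t = duhamel r z N t"
  unfolding duhamel_def by (metis (no_types, lifting) integral_cong)

lemma duhamel_cmult:
  fixes c z :: complex
  shows "duhamel r (c * z) (\<lambda>s. c * N s) t = c * duhamel r z N t"
proof -
  have "integral {0..t} (\<lambda>s. exp (r * s) *\<^sub>R (c * N s)) = c * integral {0..t} (\<lambda>s. exp (r * s) *\<^sub>R N s)"
    by (simp flip: mult_scaleR_right)
  then show ?thesis
    by (simp add: duhamel_def distrib_left)
qed

lemma cnj_duhamel: "cnj (duhamel r z N t) = duhamel r (cnj z) (\<lambda>s. cnj (N s)) t"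
  by (simp add: duhamel_def integral_cnj)

lemma fourier_parity_duhamel:
  assumes "fourier_parity p a" "\<And>s. s \<in> {0..t} \<Longrightarrow> fourier_parity p (N s)"
  shows "fourier_parity p (\<lambda>k. duhamel (r * \<bar>of_int k\<bar>) (a k) (\<lambda>s. N s k) t)"
  unfolding fourier_parity_def
proof (intro allI conjI)
  fix k
  have parity_a: "a (- k) = p * a k" "cnj (a k) = p * a k"
    using assms(1) by (auto simp: fourier_parity_def)
  have parity_N: "N s (- k) = p * N s k" "cnj (N s k) = p * N s k" if "s \<in> {0..t}" for s
    using assms(2)[OF that] by (auto simp: fourier_parity_def)
  show "duhamel (r * \<bar>of_int (- k)\<bar>) (a (- k)) (\<lambda>s. N s (- k)) t =
      p * duhamel (r * \<bar>of_int k\<bar>) (a k) (\<lambda>s. N s k) t"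
    unfolding parity_a duhamel_cmult[symmetric] of_int_minus abs_minus_cancel
    by (rule duhamel_cong) (rule parity_N)
  show "cnj (duhamel (r * \<bar>of_int k\<bar>) (a k) (\<lambda>s. N s k) t) =
      p * duhamel (r * \<bar>of_int k\<bar>) (a k) (\<lambda>s. N s k) t"
    unfolding cnj_duhamel parity_a duhamel_cmult[symmetric] by (rule duhamel_cong) (rule parity_N)
qed

lemma norm_duhamel_le:
  assumes cont_N: "continuous_on {0..t} N" and cont_b: "continuous_on {0..t} b"
    and N_le_b: "\<And>s. s \<in> {0..t} \<Longrightarrow> norm (N s) \<le> b s"
  shows "norm (duhamel r z N t) \<le>
      exp (- (r * t)) * norm z + integral {0..t} (\<lambda>s. exp (- (r * (t - s))) * b s)"
proof -
  have "norm (integral {0..t} (\<lambda>s. exp (r * s) *\<^sub>R N s)) \<le> integral {0..t} (\<lambda>s. exp (r * s) * b s)"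
    by (intro integral_norm_bound_integral integrable_continuous_real continuous_intros cont_N cont_b)
       (use N_le_b in auto)
  then have "norm (duhamel r z N t) \<le>
      exp (- (r * t)) * (norm z + integral {0..t} (\<lambda>s. exp (r * s) * b s))"
    by (simp add: duhamel_def norm_triangle_le)
  also have "\<dots> = exp (- (r * t)) * norm z + integral {0..t} (\<lambda>s. exp (- (r * t)) * (exp (r * s) * b s))"
    by (simp add: distrib_left)
  also have "(\<lambda>s. exp (- (r * t)) * (exp (r * s) * b s)) = (\<lambda>s. exp (- (r * (t - s))) * b s)"
    by (simp add: right_diff_distrib exp_diff exp_minus divide_inverse mult_ac)
  finally show ?thesis .
qed

lemma integral_exp_mult:
  fixes r :: real
  assumes "r \<noteq> 0" "0 \<le> t"
  shows "integral {0..t} (\<lambda>s. exp (r * s)) = (exp (r * t) - 1) / r"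
proof -
  have "((\<lambda>s. exp (r * s) / r) has_real_derivative exp (r * s)) (at s within {0..t})" for s
    using \<open>r \<noteq> 0\<close> by (auto intro!: derivative_eq_intros)
  then have "((\<lambda>s. exp (r * s)) has_integral exp (r * t) / r - exp (r * 0) / r) {0..t}"
    using \<open>0 \<le> t\<close> by (intro fundamental_theorem_of_calculus)
       (auto simp: has_real_derivative_iff_has_vector_derivative)
  then show ?thesis
    by (simp add: integral_unique diff_divide_distrib)
qed

text \<open>For small \<open>n\<close> the first factor decays too slowly (not at all for \<open>n = 1\<close>) and the second one
  is integrated; for large \<open>n\<close> it is the other way round.\<close>
lemma integral_exp_decay_le:
  fixes C n t :: real
  assumes C_pos: "0 < C" and n_ge_1: "1 \<le> n" and t_nonneg: "0 \<le> t"
  shows "integral {0..t} (\<lambda>s. exp (- (C * (t - s) * (n - 1) / 2)) * exp (- (C * s))) \<le> 4 / (C * n)"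
proof (cases "n \<le> 4")
  case True
  have "integral {0..t} (\<lambda>s. exp (- (C * (t - s) * (n - 1) / 2)) * exp (- (C * s))) \<le>
      integral {0..t} (\<lambda>s. exp (- C * s))"
    by (intro integral_le integrable_continuous_real continuous_intros) (use C_pos n_ge_1 in auto)
  also have "\<dots> \<le> 1 / C"
    using C_pos t_nonneg by (subst integral_exp_mult) (auto simp: field_simps)
  also have "\<dots> \<le> 4 / (C * n)"
    using True C_pos n_ge_1 by (simp add: field_simps)
  finally show ?thesis .
next
  case False
  define r where "r = C * n / 4"
  have "0 < r" using C_pos n_ge_1 by (simp add: r_def)
  have "integral {0..t} (\<lambda>s. exp (- (C * (t - s) * (n - 1) / 2)) * exp (- (C * s))) \<le>
      integral {0..t} (\<lambda>s. exp (- (r * t)) * exp (r * s))"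
  proof (intro integral_le integrable_continuous_real continuous_intros)
    fix s assume s_in: "s \<in> {0..t}"
    have "C * (t - s) * (n / 4) \<le> C * (t - s) * ((n - 1) / 2)"
      using False C_pos s_in by (intro mult_left_mono) auto
    then have "r * (t - s) \<le> C * (t - s) * (n - 1) / 2"
      by (simp add: r_def mult_ac)
    moreover have "0 \<le> C * s"
      using C_pos s_in by simp
    ultimately have "- (C * (t - s) * (n - 1) / 2) + - (C * s) \<le> - (r * t) + r * s"
      using right_diff_distrib[of r t s] by linarith
    then show "exp (- (C * (t - s) * (n - 1) / 2)) * exp (- (C * s)) \<le> exp (- (r * t)) * exp (r * s)"
      by (simp flip: exp_add)
  qed auto
  also have "\<dots> = (1 - exp (- (r * t))) / r"
    unfolding integral_mult_right
    using \<open>0 < r\<close> t_nonneg by (subst integral_exp_mult) (auto simp: right_diff_distrib mult_exp_exp)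
  also have "\<dots> \<le> 1 / r"
    using \<open>0 < r\<close> by (intro divide_right_mono) auto
  finally show ?thesis
    by (simp add: r_def)
qed

lemma norm_duhamel_decay_le:
  assumes C_pos: "0 < C" and n_ge_1: "1 \<le> n" and t_nonneg: "0 \<le> t" and cont: "continuous_on {0..} N"
    and N_bound: "\<And>s. 0 \<le> s \<Longrightarrow> norm (N s) \<le> B * exp (- (C * s / 2))^3 * exp (- (C * s / 2 * n))"
  shows "norm (duhamel (C * n) z N t) \<le>
      (norm z + 4 * B / (C * n)) * (exp (- (C * t / 2)) * exp (- (C * t / 2 * n)))"
proof -
  define E where "E = exp (- (C * t / 2)) * exp (- (C * t / 2 * n))"
  have "0 \<le> B"
    using order_trans[OF norm_ge_zero N_bound[of 0]] by simp
  have "norm (duhamel (C * n) z N t) \<le> exp (- (C * n * t)) * norm z +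
      integral {0..t} (\<lambda>s. exp (- (C * n * (t - s))) *
          (B * exp (- (C * s / 2))^3 * exp (- (C * s / 2 * n))))"
    by (rule norm_duhamel_le)
       (use N_bound in \<open>auto intro!: continuous_intros continuous_on_subset[OF cont]\<close>)
  also have "(\<lambda>s. exp (- (C * n * (t - s))) * (B * exp (- (C * s / 2))^3 * exp (- (C * s / 2 * n)))) =
      (\<lambda>s. B * E * (exp (- (C * (t - s) * (n - 1) / 2)) * exp (- (C * s))))"
  proof
    fix s
    have "exp (- (C * n * (t - s))) * (exp (- (C * s / 2))^3 * exp (- (C * s / 2 * n))) =
        E * (exp (- (C * (t - s) * (n - 1) / 2)) * exp (- (C * s)))"
      by (simp add: E_def exp_add[symmetric] power3_eq_cube field_simps)
    then show "exp (- (C * n * (t - s))) * (B * exp (- (C * s / 2))^3 * exp (- (C * s / 2 * n))) =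
        B * E * (exp (- (C * (t - s) * (n - 1) / 2)) * exp (- (C * s)))"
      by (simp add: mult_ac)
  qed
  also have "exp (- (C * n * t)) * norm z \<le> E * norm z"
  proof (rule mult_right_mono)
    have "C * t * 1 \<le> C * t * n"
      using C_pos n_ge_1 t_nonneg by (intro mult_left_mono) auto
    then show "exp (- (C * n * t)) \<le> E"
      by (simp add: E_def exp_add[symmetric] field_simps)
  qed simp
  also have "integral {0..t} (\<lambda>s. B * E * (exp (- (C * (t - s) * (n - 1) / 2)) * exp (- (C * s)))) \<le>
      B * E * (4 / (C * n))"
    unfolding integral_mult_right
    using \<open>0 \<le> B\<close> by (intro mult_left_mono integral_exp_decay_le[OF C_pos n_ge_1 t_nonneg])
       (simp add: E_def)
  finally show ?thesis
    by (simp add: E_def algebra_simps)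
qed

section \<open>Bounded continuous functions of time and discrete parameters\<close>

text \<open>The library instance asks for a metric on the domain, which \<open>nat\<close> and \<open>int\<close> do not carry.\<close>
lemma complete_UNIV_bcontfun:
  "complete (UNIV :: ('a::topological_space \<Rightarrow>\<^sub>C 'b::complete_space) set)"
proof (rule completeI)
  fix f :: "nat \<Rightarrow> 'a \<Rightarrow>\<^sub>C 'b"
  assume "Cauchy f"
  have "uniformly_Cauchy_on UNIV (\<lambda>n. apply_bcontfun (f n))"
  proof (rule uniformly_Cauchy_onI)
    fix d :: real assume "0 < d"
    then obtain M where "\<forall>m\<ge>M. \<forall>n\<ge>M. dist (f m) (f n) < d"
      using \<open>Cauchy f\<close> by (auto simp: Cauchy_def)
    then show "\<exists>M. \<forall>x\<in>UNIV. \<forall>m\<ge>M. \<forall>n\<ge>M. dist (apply_bcontfun (f m) x) (apply_bcontfun (f n) x) < d"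
      by (meson dist_fun_lt_imp_dist_val_lt)
  qed
  then obtain g where "uniform_limit UNIV (\<lambda>n. apply_bcontfun (f n)) g sequentially"
    using Cauchy_uniformly_convergent uniformly_convergent_on_def by metis
  from uniform_limit_bcontfunE[OF this sequentially_bot]
  show "\<exists>l\<in>UNIV. f \<longlonglongrightarrow> l" by (metis UNIV_I)
qed

lemma continuous_on_eval_bcontfun: "continuous_on S (\<lambda>u. apply_bcontfun u z)"
proof (rule lipschitz_on_continuous_on)
  show "1-lipschitz_on S (\<lambda>u. apply_bcontfun u z)"
    by (rule lipschitz_onI) (auto simp: dist_bounded)
qed

lemma continuous_on_discrete_params:
  fixes f :: "'i::{discrete_topology,t2_space} \<times> 'a::t2_space \<times> 'j::{discrete_topology,t2_space} \<Rightarrow>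
    'b::topological_space"
  assumes "\<And>i k. continuous_on UNIV (\<lambda>t. f (i, t, k))"
  shows "continuous_on UNIV f"
  unfolding continuous_on_eq_continuous_at[OF open_UNIV]
proof safe
  fix i t k
  have "isCont (\<lambda>t. f (i, t, k)) t"
    using assms by (simp add: continuous_on_eq_continuous_at)
  then have "isCont (\<lambda>z. f (i, fst (snd z), k)) (i, t, k)"
    by (intro isCont_o2[where g = "\<lambda>t. f (i, t, k)" and f = "\<lambda>z. fst (snd z)"])
       (auto intro!: continuous_intros)
  moreover have "open ({i} \<times> UNIV \<times> {k} :: ('i \<times> 'a \<times> 'j) set)"
    by (intro open_Times open_UNIV open_discrete)
  then have "\<forall>\<^sub>F z in nhds (i, t, k). z \<in> {i} \<times> UNIV \<times> {k}"
    by (rule eventually_nhds_in_open) auto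
  then have "\<forall>\<^sub>F z in nhds (i, t, k). f z = f (i, fst (snd z), k)"
    by (rule eventually_mono) auto
  ultimately show "isCont f (i, t, k)"
    using isCont_cong[of f "\<lambda>z. f (i, fst (snd z), k)" "(i, t, k)"] by simp
qed

lemma norm_divideR_le: "norm x \<le> r * s \<Longrightarrow> 0 \<le> s \<Longrightarrow> 0 \<le> r \<Longrightarrow> norm (x /\<^sub>R s) \<le> r"
  by (cases "s = 0") (auto simp: field_simps)

section \<open>The contraction\<close>

definition decay_rate :: "real \<Rightarrow> real" where
  "decay_rate l = l^2 / (1 + l^2)"

lemma decay_rate_eq: "decay_rate l = 1 - 1 / (1 + l^2)"
  by (simp add: decay_rate_def field_simps add_nonneg_eq_0_iff)

lemma decay_rate_pos: "l \<noteq> 0 \<Longrightarrow> 0 < decay_rate l"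
  by (simp add: decay_rate_def add_pos_nonneg)

lemma decay_rate_less_1: "decay_rate l < 1"
  by (simp add: decay_rate_eq add_pos_nonneg)

text \<open>The unknown \<open>a i t k\<close> is the Fourier coefficient at frequency \<open>k\<close> and time \<open>t\<close> of \<open>f\<close> for \<open>i = 0\<close>,
  of \<open>f_x^2 / (1 + f_x^2)\<close> for \<open>i = 1\<close> and of \<open>1 / (1 + l^2 - f^2) - 1 / (1 + l^2)\<close> for all \<open>i \<ge> 2\<close>.
  Treating the two quotients as unknowns determined by linear equations makes the whole system
  polynomial.\<close>
type_synonym coeff_family = "nat \<Rightarrow> real \<Rightarrow> int \<Rightarrow> complex"

locale small_odd_data =
  fixes l e :: real and a0 :: "int \<Rightarrow> complex"
  assumes l_pos: "0 < l" and e_pos: "0 < e" and small: "conv_const * e \<le> decay_rate l / 128"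
    and a0_parity: "fourier_parity (- 1) a0" and a0_bound: "\<And>k. \<bar>of_int k\<bar> ^ 3 * cmod (a0 k) \<le> e / 2"
begin

abbreviation C :: real where "C \<equiv> decay_rate l"

definition damping :: "real \<Rightarrow> real" where
  "damping t = exp (- (C * t / 2))"

text \<open>Division by zero makes \<open>envelope 0 t 0 = 0\<close>; it forces the mode \<open>k = 0\<close> of \<open>f\<close> to vanish.\<close>
definition envelope :: "nat \<Rightarrow> real \<Rightarrow> int \<Rightarrow> real" where
  "envelope i t k = (if i = 0 then damping t * exp (- (C * t / 2 * \<bar>of_int k\<bar>)) / \<bar>of_int k\<bar> ^ 3
    else damping t ^ 2 * exp_weight (C * t / 2) k)"

definition envelope_bounded :: "real \<Rightarrow> coeff_family \<Rightarrow> bool" where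
  "envelope_bounded r a \<longleftrightarrow> (\<forall>i t k. 0 \<le> t \<longrightarrow> cmod (a i t k) \<le> r * envelope i t k)"

definition time_continuous :: "coeff_family \<Rightarrow> bool" where
  "time_continuous a \<longleftrightarrow> (\<forall>i k. continuous_on {0..} (\<lambda>t. a i t k))"

definition respects_parity :: "coeff_family \<Rightarrow> bool" where
  "respects_parity a \<longleftrightarrow> (\<forall>i t. 0 \<le> t \<longrightarrow> fourier_parity (if i = 0 then - 1 else 1) (a i t))"

definition admissible :: "coeff_family \<Rightarrow> bool" where
  "admissible a \<longleftrightarrow> envelope_bounded e a \<and> time_continuous a \<and> respects_parity a"

definition nonlinearity :: "coeff_family \<Rightarrow> real \<Rightarrow> int \<Rightarrow> complex" where
  "nonlinearity a t = conv (\<lambda>k. a 1 t k + a 2 t k) (\<lambda>k. of_int \<bar>k\<bar> * a 0 t k)"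

definition solution_map :: "coeff_family \<Rightarrow> coeff_family" where
  "solution_map a i t =
    (if i = 0 then \<lambda>k. duhamel (C * \<bar>of_int k\<bar>) (a0 k) (\<lambda>s. nonlinearity a s k) t
     else if i = 1 then geometric_map 1 (- 1) (\<lambda>k. \<i> * of_int k * a 0 t k) (a 1 t)
     else geometric_map (of_real (1 / (1 + l^2)^2)) (of_real (1 / (1 + l^2))) (a 0 t) (a 2 t))"

lemma solution_map_profile:
  "solution_map a 0 t k = duhamel (C * \<bar>of_int k\<bar>) (a0 k) (\<lambda>s. nonlinearity a s k) t"
  by (simp add: solution_map_def)

lemma C_pos: "0 < C"
  using l_pos by (intro decay_rate_pos) simp

lemma C_nonneg: "0 \<le> t \<Longrightarrow> 0 \<le> C * t / 2"
  using C_pos by simp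

lemma conv_const_e_nonneg: "0 \<le> conv_const * e"
  using conv_const_ge_1 e_pos by simp

lemma conv_const_e_le: "conv_const * e \<le> 1 / 128"
  using small decay_rate_less_1[of l] by linarith

lemma damping_pos [simp]: "0 < damping t"
  by (simp add: damping_def)

lemma damping_nonneg [simp]: "0 \<le> damping t"
  by (simp add: damping_def)

lemma damping_le_1: "0 \<le> t \<Longrightarrow> damping t \<le> 1"
  using C_nonneg by (simp add: damping_def)

lemma envelope_nonneg: "0 \<le> envelope i t k"
  by (simp add: envelope_def)

lemma envelope_eq_0_iff: "envelope i t k = 0 \<longleftrightarrow> i = 0 \<and> k = 0"
  using damping_pos[of t] exp_weight_pos[of "C * t / 2" k]
  by (auto simp: envelope_def simp del: damping_pos exp_weight_pos)

lemma envelope_0_mult_abs_le: "\<bar>of_int k\<bar> * envelope 0 t k \<le> 4 * damping t * exp_weight (C * t / 2) k"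
proof (cases "k = 0")
  case False
  define n where "n = \<bar>real_of_int k\<bar>"
  have n_ge_1: "1 \<le> n" using False by (simp add: n_def)
  then have "(1 + n)^2 \<le> (2 * n)^2" by (intro power_mono) auto
  then have "1 / n^2 \<le> 4 / (1 + n)^2"
    using n_ge_1 by (simp add: field_simps)
  then have "damping t * exp (- (C * t / 2 * n)) * (1 / n^2) \<le>
      damping t * exp (- (C * t / 2 * n)) * (4 / (1 + n)^2)"
    by (intro mult_left_mono) auto
  then show ?thesis
    using n_ge_1 by (simp add: envelope_def exp_weight_def power2_eq_square power3_eq_cube mult_ac
        flip: n_def)
qed simp

lemma damping_mult_exp_weight_le:
  assumes "0 \<le> t" "k \<noteq> 0"
  shows "damping t * exp_weight (C * t / 2) k \<le> exp (- (C * t)) * exp_weight 0 k"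
proof -
  have "C * t * 1 \<le> C * t * \<bar>of_int k\<bar>"
    using C_pos assms by (intro mult_left_mono) auto
  then have "damping t * exp (- (C * t / 2 * \<bar>of_int k\<bar>)) \<le> exp (- (C * t))"
    by (simp add: damping_def exp_add[symmetric] field_simps)
  then show ?thesis
    unfolding exp_weight_def times_divide_eq_right by (intro divide_right_mono) auto
qed

text \<open>The hypothesis on \<open>b\<close> covers the coefficients of \<open>f\<close>, \<open>f_x\<close> and \<open>\<Lambda>f\<close> at once.\<close>
lemma weight_bounded_profile:
  assumes a_bounded: "envelope_bounded r a" and t_nonneg: "0 \<le> t"
    and b_le: "\<And>k. cmod (b k) \<le> \<bar>of_int k\<bar> * cmod (a 0 t k)"
  shows "weight_bounded (C * t / 2) (4 * r * damping t) b"
    and "weight_bounded 0 (4 * r * exp (- (C * t))) b"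
proof -
  have profile_le: "cmod (a 0 t k) \<le> r * envelope 0 t k" for k
    using a_bounded t_nonneg by (simp add: envelope_bounded_def)
  have r_nonneg: "0 \<le> r"
    using order_trans[OF norm_ge_zero profile_le[of 1]] envelope_nonneg[of 0 t 1]
        envelope_eq_0_iff[of 0 t 1]
    by (auto simp: zero_le_mult_iff)
  have b_bound: "cmod (b k) \<le> 4 * r * (damping t * exp_weight (C * t / 2) k)" for k
  proof -
    have "cmod (b k) \<le> \<bar>of_int k\<bar> * (r * envelope 0 t k)"
      using b_le[of k] mult_left_mono[OF profile_le] order_trans abs_ge_zero by blast
    also have "\<dots> = r * (\<bar>of_int k\<bar> * envelope 0 t k)"
      by (simp add: mult_ac)
    also have "\<dots> \<le> r * (4 * damping t * exp_weight (C * t / 2) k)"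
      by (rule mult_left_mono[OF envelope_0_mult_abs_le r_nonneg])
    finally show ?thesis by (simp add: mult_ac)
  qed
  then show "weight_bounded (C * t / 2) (4 * r * damping t) b"
    by (simp add: weight_bounded_def mult.assoc)
  have "cmod (b k) \<le> 4 * r * exp (- (C * t)) * exp_weight 0 k" for k
  proof (cases "k = 0")
    case True
    then show ?thesis using b_le[of k] r_nonneg by simp
  next
    case False
    then show ?thesis
      using order_trans[OF b_bound mult_left_mono[OF damping_mult_exp_weight_le[OF t_nonneg False]]]
          r_nonneg
      by (simp add: mult.assoc)
  qed
  then show "weight_bounded 0 (4 * r * exp (- (C * t))) b"
    by (simp add: weight_bounded_def)
qed

lemma cmod_profile_le:
  assumes "envelope_bounded r a" "0 \<le> t"
  shows "cmod (a 0 t k) \<le> \<bar>of_int k\<bar> * cmod (a 0 t k)"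
proof (cases "k = 0")
  case True
  have "cmod (a 0 t 0) \<le> r * envelope 0 t 0"
    using assms unfolding envelope_bounded_def by blast
  then show ?thesis using True by (simp add: envelope_def)
next
  case False
  then show ?thesis
    using mult_right_mono[of 1 "\<bar>real_of_int k\<bar>" "cmod (a 0 t k)"] by simp
qed

lemma weight_bounded_quotient:
  assumes "envelope_bounded r a" "0 \<le> t" "0 < i"
  shows "weight_bounded (C * t / 2) (r * damping t ^ 2) (a i t)"
  unfolding weight_bounded_def
proof
  fix k
  have "cmod (a i t k) \<le> r * envelope i t k"
    using assms by (simp add: envelope_bounded_def)
  then show "cmod (a i t k) \<le> r * damping t ^ 2 * exp_weight (C * t / 2) k"
    using \<open>0 < i\<close> by (simp add: envelope_def mult.assoc)
qed

lemma weight_bounded_Lambda: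
  assumes "envelope_bounded r a" "0 \<le> t"
  shows "weight_bounded (C * t / 2) (4 * r * damping t) (\<lambda>k. of_int \<bar>k\<bar> * a 0 t k)"
  by (rule weight_bounded_profile[OF assms]) (simp add: norm_mult)

lemma weight_bounded_quotient_sum:
  assumes "envelope_bounded r a" "0 \<le> t"
  shows "weight_bounded (C * t / 2) (2 * r * damping t ^ 2) (\<lambda>k. a 1 t k + a 2 t k)"
  using weight_bounded_add[OF weight_bounded_quotient[OF assms]
      weight_bounded_quotient[OF assms], of 1 2]
  by (simp add: algebra_simps)

lemma weight_bounded_nonlinearity:
  assumes "envelope_bounded e a" "0 \<le> t"
  shows "weight_bounded (C * t / 2) (8 * (conv_const * e) * e * damping t ^ 3) (nonlinearity a t)"
  using weight_bounded_conv[OF C_nonneg[OF assms(2)] weight_bounded_quotient_sum[OF assms]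
      weight_bounded_Lambda[OF assms]]
  by (simp add: nonlinearity_def power2_eq_square power3_eq_cube mult_ac)

lemma weight_bounded_nonlinearity_diff:
  assumes a_bounded: "envelope_bounded e a" and b_bounded: "envelope_bounded e b"
    and diff_bounded: "envelope_bounded d (\<lambda>i t k. a i t k - b i t k)"
    and t_nonneg: "0 \<le> t"
  shows "weight_bounded (C * t / 2) (16 * (conv_const * e) * d * damping t ^ 3)
    (\<lambda>k. nonlinearity a t k - nonlinearity b t k)"
proof -
  have "weight_bounded (C * t / 2)
      (conv_const * (2 * d * damping t ^ 2) * (4 * e * damping t) +
       conv_const * (2 * e * damping t ^ 2) * (4 * d * damping t))
      (\<lambda>k. nonlinearity a t k - nonlinearity b t k)"
    unfolding nonlinearity_def
  proof (rule weight_bounded_conv_diff)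
    show "weight_bounded (C * t / 2) (2 * d * damping t ^ 2)
        (\<lambda>k. a 1 t k + a 2 t k - (b 1 t k + b 2 t k))"
      using weight_bounded_quotient_sum[OF diff_bounded t_nonneg] by (simp add: algebra_simps)
    show "weight_bounded (C * t / 2) (4 * d * damping t)
        (\<lambda>k. of_int \<bar>k\<bar> * a 0 t k - of_int \<bar>k\<bar> * b 0 t k)"
      using weight_bounded_Lambda[OF diff_bounded t_nonneg] by (simp add: right_diff_distrib)
  qed (rule C_nonneg[OF t_nonneg] weight_bounded_quotient_sum[OF a_bounded t_nonneg]
      weight_bounded_quotient_sum[OF b_bounded t_nonneg]
      weight_bounded_Lambda[OF a_bounded t_nonneg] weight_bounded_Lambda[OF b_bounded t_nonneg])+
  then show ?thesis
    by (simp add: power2_eq_square power3_eq_cube mult_ac)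
qed

lemma envelope_bounded_imp_weight_bounded_0:
  assumes a_bounded: "envelope_bounded e a" and t_nonneg: "0 \<le> t"
  shows "weight_bounded 0 (4 * e) (\<lambda>k. of_int \<bar>k\<bar> * a 0 t k)"
    and "weight_bounded 0 (4 * e) (\<lambda>k. \<i> * of_int k * a 0 t k)"
    and "weight_bounded 0 (4 * e) (a 0 t)"
    and "0 < i \<Longrightarrow> weight_bounded 0 e (a i t)"
    and "weight_bounded 0 (8 * (conv_const * e) * e) (nonlinearity a t)"
proof -
  have "4 * e * exp (- (C * t)) \<le> 4 * e"
    using C_pos e_pos t_nonneg by simp
  note profile = weight_bounded_mono[OF weight_bounded_profile(2)[OF a_bounded t_nonneg] this
      order.refl]
  show "weight_bounded 0 (4 * e) (\<lambda>k. of_int \<bar>k\<bar> * a 0 t k)"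
    "weight_bounded 0 (4 * e) (\<lambda>k. \<i> * of_int k * a 0 t k)"
    "weight_bounded 0 (4 * e) (a 0 t)"
    by (rule profile; use cmod_profile_le[OF a_bounded t_nonneg] in \<open>simp add: norm_mult\<close>)+
  have damping_power_le_1: "damping t ^ n \<le> 1" for n
    using damping_le_1[OF t_nonneg] by (simp add: power_le_one)
  show "weight_bounded 0 e (a i t)" if "0 < i"
    using e_pos mult_left_mono[OF damping_power_le_1[of 2], of e]
    by (intro weight_bounded_mono[OF weight_bounded_quotient[OF a_bounded t_nonneg that] _
          C_nonneg[OF t_nonneg]]) auto
  show "weight_bounded 0 (8 * (conv_const * e) * e) (nonlinearity a t)"
    using e_pos conv_const_e_nonneg
        mult_left_mono[OF damping_power_le_1[of 3], of "8 * (conv_const * e) * e"]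
    by (intro weight_bounded_mono[OF weight_bounded_nonlinearity[OF a_bounded t_nonneg] _
          C_nonneg[OF t_nonneg]]) auto
qed

lemma continuous_on_nonlinearity:
  assumes a_bounded: "envelope_bounded e a" and cont: "time_continuous a"
  shows "continuous_on {0..} (\<lambda>t. nonlinearity a t k)"
  unfolding nonlinearity_def
proof (rule continuous_on_conv)
  show "weight_bounded 0 (e + e) (\<lambda>k. a 1 t k + a 2 t k)" if "t \<in> {0..}" for t
    using that by (intro weight_bounded_add envelope_bounded_imp_weight_bounded_0(4)[OF a_bounded]) auto
  show "weight_bounded 0 (4 * e) (\<lambda>k. of_int \<bar>k\<bar> * a 0 t k)" if "t \<in> {0..}" for t
    using envelope_bounded_imp_weight_bounded_0(1)[OF a_bounded] that by auto
qed (use cont in \<open>auto simp: time_continuous_def intro!: continuous_intros\<close>)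

subsection \<open>Bounds on the Duhamel integral\<close>

lemma norm_duhamel_le_envelope:
  assumes "0 \<le> t" "k \<noteq> 0" "0 \<le> B" and cont: "continuous_on {0..} N"
    and N_bound: "\<And>s. 0 \<le> s \<Longrightarrow> cmod (N s) \<le> B * damping s ^ 3 * exp_weight (C * s / 2) k"
  shows "cmod (duhamel (C * \<bar>of_int k\<bar>) z N t) \<le> (\<bar>of_int k\<bar> ^ 3 * cmod z + 4 * B / C) * envelope 0 t k"
proof -
  define n where "n = \<bar>real_of_int k\<bar>"
  have n_ge_1: "1 \<le> n" using \<open>k \<noteq> 0\<close> by (simp add: n_def)
  define E where "E = damping t * exp (- (C * t / 2 * n))"
  have "cmod (duhamel (C * n) z N t) \<le> (cmod z + 4 * (B / (1 + n)^2) / (C * n)) * E"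
    unfolding E_def damping_def
    using N_bound by (intro norm_duhamel_decay_le C_pos n_ge_1 \<open>0 \<le> t\<close> cont)
       (simp add: damping_def exp_weight_def n_def mult_ac)
  also have "\<dots> \<le> (cmod z + 4 * (B / n^2) / (C * n)) * E"
    using n_ge_1 \<open>0 \<le> B\<close> C_pos
    by (intro mult_right_mono add_left_mono divide_right_mono mult_left_mono divide_left_mono
          power_mono)
       (auto simp: E_def)
  also have "\<dots> = (n ^ 3 * cmod z + 4 * B / C) * (E / n ^ 3)"
    using n_ge_1 by (simp add: field_simps power2_eq_square power3_eq_cube)
  finally show ?thesis
    by (simp add: envelope_def E_def n_def)
qed

lemma solution_map_profile_diff_bound:
  assumes a_assms: "envelope_bounded e a" "time_continuous a"
    and b_assms: "envelope_bounded e b" "time_continuous b"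
    and diff_bounded: "envelope_bounded d (\<lambda>i t k. a i t k - b i t k)" and d_nonneg: "0 \<le> d"
    and t_nonneg: "0 \<le> t" and k_nonzero: "k \<noteq> 0"
  shows "cmod (solution_map a 0 t k - solution_map b 0 t k) \<le> 1 / 2 * d * envelope 0 t k"
proof -
  note cont = continuous_on_nonlinearity[OF a_assms] continuous_on_nonlinearity[OF b_assms]
  have "solution_map a 0 t k - solution_map b 0 t k =
      duhamel (C * \<bar>of_int k\<bar>) 0 (\<lambda>s. nonlinearity a s k - nonlinearity b s k) t"
    unfolding solution_map_profile
    by (intro duhamel_diff continuous_on_subset[OF cont(1)] continuous_on_subset[OF cont(2)]) auto
  also have "cmod \<dots> \<le> (\<bar>of_int k\<bar> ^ 3 * cmod 0 + 4 * (16 * (conv_const * e) * d) / C) * envelope 0 t k"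
    using weight_bounded_nonlinearity_diff[OF a_assms(1) b_assms(1) diff_bounded]
        conv_const_e_nonneg d_nonneg
    by (intro norm_duhamel_le_envelope t_nonneg k_nonzero continuous_on_diff cont)
       (auto simp: weight_bounded_def)
  also have "\<dots> \<le> 1 / 2 * d * envelope 0 t k"
  proof (intro mult_right_mono envelope_nonneg)
    show "\<bar>of_int k\<bar> ^ 3 * cmod 0 + 4 * (16 * (conv_const * e) * d) / C \<le> 1 / 2 * d"
      using mult_right_mono[OF small d_nonneg] C_pos by (simp add: field_simps)
  qed
  finally show ?thesis .
qed

subsection \<open>Bounds on the quotients\<close>

lemma geometric_map_diff_bound:
  assumes t_nonneg: "0 \<le> t" and d_nonneg: "0 \<le> d" and \<sigma>_le_1: "cmod \<sigma> \<le> 1" and \<tau>_le_1: "cmod \<tau> \<le> 1"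
    and b_bounds: "weight_bounded (C * t / 2) (4 * e * damping t) b"
      "weight_bounded (C * t / 2) (4 * e * damping t) b'"
      "weight_bounded (C * t / 2) (4 * d * damping t) (\<lambda>k. b k - b' k)"
    and q_bounds: "weight_bounded (C * t / 2) (e * damping t ^ 2) q"
      "weight_bounded (C * t / 2) (e * damping t ^ 2) q'"
      "weight_bounded (C * t / 2) (d * damping t ^ 2) (\<lambda>k. q k - q' k)"
  shows "weight_bounded (C * t / 2) (1 / 2 * d * damping t ^ 2)
    (\<lambda>k. geometric_map \<sigma> \<tau> b q k - geometric_map \<sigma> \<tau> b' q' k)"
proof -
  define K m where "K = conv_const * e" and "m = damping t"
  have K_bounds: "0 \<le> K" "K \<le> 1 / 128" and m_power_le: "m^4 \<le> m^2"
    using conv_const_e_nonneg conv_const_e_le damping_le_1[OF t_nonneg]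
    by (auto simp: K_def m_def intro: power_decreasing)
  have "cmod \<sigma> * (conv_const * (4 * d * m) * (4 * e * m) + conv_const * (4 * e * m) * (4 * d * m)) +
      cmod \<tau> * (conv_const * (conv_const * (4 * d * m) * (4 * e * m) +
                                conv_const * (4 * e * m) * (4 * d * m)) * (e * m^2) +
        conv_const * (conv_const * (4 * e * m) * (4 * e * m)) * (d * m^2)) =
      cmod \<sigma> * (32 * K * (d * m^2)) + cmod \<tau> * (48 * K^2 * d * m^4)"
    by (simp add: K_def power2_eq_square power4_eq_xxxx algebra_simps)
  also have "\<dots> \<le> 1 * (32 * K * (d * m^2)) + 1 * (48 * K^2 * d * m^2)"
    using \<sigma>_le_1 \<tau>_le_1 K_bounds m_power_le d_nonneg by (intro add_mono mult_mono) (auto simp: m_def)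
  also have "\<dots> = (32 * K + 48 * K^2) * (d * m^2)"
    by (simp add: algebra_simps)
  also have "\<dots> \<le> 1 / 2 * (d * m^2)"
    using K_bounds mult_left_mono[OF K_bounds(2) K_bounds(1)] d_nonneg
    by (intro mult_right_mono) (auto simp: power2_eq_square)
  finally have "cmod \<sigma> * (conv_const * (4 * d * m) * (4 * e * m) + conv_const * (4 * e * m) * (4 * d * m)) +
      cmod \<tau> * (conv_const * (conv_const * (4 * d * m) * (4 * e * m) +
                                conv_const * (4 * e * m) * (4 * d * m)) * (e * m^2) +
        conv_const * (conv_const * (4 * e * m) * (4 * e * m)) * (d * m^2)) \<le> 1 / 2 * d * m^2"
    by simp
  then show ?thesis
    unfolding m_def
    by (rule weight_bounded_mono[OF
          weight_bounded_geometric_map_diff[OF C_nonneg[OF t_nonneg] b_bounds q_bounds] _ order.refl])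
qed

subsection \<open>The fixed point\<close>

lemma respects_parityD:
  assumes "respects_parity a" "0 \<le> t"
  shows "fourier_parity (- 1) (a 0 t)" and "0 < i \<Longrightarrow> fourier_parity 1 (a i t)"
proof -
  have "fourier_parity (if i = 0 then - 1 else 1) (a i t)" for i
    using assms by (simp add: respects_parity_def)
  from this[of 0] this[of i] show "fourier_parity (- 1) (a 0 t)" "0 < i \<Longrightarrow> fourier_parity 1 (a i t)"
    by auto
qed

lemma fourier_parity_nonlinearity:
  assumes "respects_parity a" "0 \<le> t"
  shows "fourier_parity (- 1) (nonlinearity a t)"
proof -
  note parity = respects_parityD[OF assms]
  have "fourier_parity (1 * - 1) (nonlinearity a t)"
    unfolding nonlinearity_def
    by (intro fourier_parity_conv fourier_parity_add fourier_parity_abs parity) auto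
  then show ?thesis by simp
qed

lemma respects_parity_solution_map:
  assumes "respects_parity a"
  shows "respects_parity (solution_map a)"
  unfolding respects_parity_def
proof (intro allI impI)
  fix i :: nat and t :: real assume t_nonneg: "0 \<le> t"
  note parity = respects_parityD[OF assms t_nonneg]
  consider (profile) "i = 0" | (slope) "i = 1" | (height) "i \<ge> 2" by linarith
  then show "fourier_parity (if i = 0 then - 1 else 1) (solution_map a i t)"
  proof cases
    case profile
    have "fourier_parity (- 1) (\<lambda>k. duhamel (C * \<bar>of_int k\<bar>) (a0 k) (\<lambda>s. nonlinearity a s k) t)"
      using fourier_parity_nonlinearity[OF assms]
      by (intro fourier_parity_duhamel a0_parity) auto
    then show ?thesis
      using profile by (simp add: solution_map_def)
  next
    case slope
    then show ?thesis
      using fourier_parity_geometric_map[OF fourier_parity_deriv[OF parity(1)] _ parity(2)[of 1]]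
      by (simp add: solution_map_def)
  next
    case height
    then show ?thesis
      using fourier_parity_geometric_map[OF parity(1) _ parity(2)[of 2]]
      by (simp add: solution_map_def)
  qed
qed

lemma time_continuous_solution_map:
  assumes a_assms: "envelope_bounded e a" "time_continuous a"
  shows "time_continuous (solution_map a)"
  unfolding time_continuous_def
proof (intro allI)
  fix i :: nat and k :: int
  have cont: "continuous_on {0..} (\<lambda>t. a i t k)" for i k
    using a_assms(2) by (simp add: time_continuous_def)
  have bounded: "t \<in> {0..} \<Longrightarrow> weight_bounded 0 (4 * e) (\<lambda>k. \<i> * of_int k * a 0 t k)"
    "t \<in> {0..} \<Longrightarrow> weight_bounded 0 (4 * e) (a 0 t)"
    "t \<in> {0..} \<Longrightarrow> 0 < i \<Longrightarrow> weight_bounded 0 e (a i t)" for t i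
    using envelope_bounded_imp_weight_bounded_0(2-4)[OF a_assms(1)] by auto
  consider (profile) "i = 0" | (slope) "i = 1" | (height) "i \<ge> 2" by linarith
  then show "continuous_on {0..} (\<lambda>t. solution_map a i t k)"
  proof cases
    case profile
    then show ?thesis
      by (simp add: solution_map_profile continuous_on_duhamel continuous_on_nonlinearity a_assms)
  next
    case slope
    have "continuous_on {0..} (\<lambda>t. geometric_map 1 (- 1) (\<lambda>k. \<i> * of_int k * a 0 t k) (a 1 t) k)"
      by (rule continuous_on_geometric_map[OF _ bounded(1) cont bounded(3)])
         (auto intro!: continuous_intros cont)
    then show ?thesis
      using slope by (simp add: solution_map_def)
  next
    case height
    have "continuous_on {0..} (\<lambda>t. geometric_map \<sigma> \<tau> (a 0 t) (a 2 t) k)" for \<sigma> \<tau>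
      by (rule continuous_on_geometric_map[OF cont bounded(2) cont bounded(3)]) auto
    then show ?thesis
      using height by (simp add: solution_map_def)
  qed
qed

lemma norm_quotient_constants_le_1:
  "cmod (of_real (1 / (1 + l^2)^2)) \<le> 1" "cmod (of_real (1 / (1 + l^2))) \<le> 1"
  by (simp_all only: norm_of_real) (simp_all add: one_le_power divide_le_eq_1 add_pos_nonneg)

lemma solution_map_contraction:
  assumes admissible_a: "admissible a" and admissible_b: "admissible b"
    and diff_bounded: "envelope_bounded d (\<lambda>i t k. a i t k - b i t k)" and d_nonneg: "0 \<le> d"
  shows "envelope_bounded (1 / 2 * d) (\<lambda>i t k. solution_map a i t k - solution_map b i t k)"
  unfolding envelope_bounded_def
proof (intro allI impI)
  fix i :: nat and t :: real and k :: int assume t_nonneg: "0 \<le> t"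
  have a_assms: "envelope_bounded e a" "time_continuous a"
    and b_assms: "envelope_bounded e b" "time_continuous b"
    using admissible_a admissible_b by (auto simp: admissible_def)
  note quotients = weight_bounded_quotient[OF a_assms(1) t_nonneg]
    weight_bounded_quotient[OF b_assms(1) t_nonneg] weight_bounded_quotient[OF diff_bounded t_nonneg]
  note profiles = weight_bounded_profile(1)[OF a_assms(1) t_nonneg]
    weight_bounded_profile(1)[OF b_assms(1) t_nonneg] weight_bounded_profile(1)[OF diff_bounded t_nonneg]
  have quotient_bound: "cmod (solution_map a i t k - solution_map b i t k) \<le> 1 / 2 * d * envelope i t k"
    if "weight_bounded (C * t / 2) (1 / 2 * d * damping t ^ 2)
      (\<lambda>k. solution_map a i t k - solution_map b i t k)" "0 < i"
    using that by (simp add: weight_bounded_def envelope_def mult.assoc)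
  consider (zero_mode) "i = 0" "k = 0" | (profile) "i = 0" "k \<noteq> 0" | (slope) "i = 1" | (height) "i \<ge> 2"
    by linarith
  then show "cmod (solution_map a i t k - solution_map b i t k) \<le> 1 / 2 * d * envelope i t k"
  proof cases
    case zero_mode
    have "solution_map a 0 t 0 = 0" if "admissible a" for a
      using that respects_parityD(1)[OF respects_parity_solution_map t_nonneg]
      by (intro fourier_parity_odd_at_zero) (simp add: admissible_def)
    then show ?thesis using zero_mode admissible_a admissible_b by (simp add: envelope_def)
  next
    case profile
    then show ?thesis
      using solution_map_profile_diff_bound[OF a_assms b_assms diff_bounded d_nonneg t_nonneg] by simp
  next
    case slope
    have "weight_bounded (C * t / 2) (1 / 2 * d * damping t ^ 2)
        (\<lambda>k. geometric_map 1 (- 1) (\<lambda>k. \<i> * of_int k * a 0 t k) (a 1 t) k -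
             geometric_map 1 (- 1) (\<lambda>k. \<i> * of_int k * b 0 t k) (b 1 t) k)"
      by (intro geometric_map_diff_bound t_nonneg d_nonneg profiles quotients)
         (auto simp: norm_mult simp flip: right_diff_distrib)
    then show ?thesis using slope by (intro quotient_bound) (auto simp: solution_map_def)
  next
    case height
    have "weight_bounded (C * t / 2) (1 / 2 * d * damping t ^ 2)
        (\<lambda>k. geometric_map (of_real (1 / (1 + l^2)^2)) (of_real (1 / (1 + l^2))) (a 0 t) (a 2 t) k -
             geometric_map (of_real (1 / (1 + l^2)^2)) (of_real (1 / (1 + l^2))) (b 0 t) (b 2 t) k)"
      by (intro geometric_map_diff_bound norm_quotient_constants_le_1 t_nonneg d_nonneg profiles quotients
            cmod_profile_le[OF a_assms(1) t_nonneg] cmod_profile_le[OF b_assms(1) t_nonneg]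
            cmod_profile_le[OF diff_bounded t_nonneg]) simp_all
    then show ?thesis using height by (intro quotient_bound) (auto simp: solution_map_def)
  qed
qed

lemma solution_map_zero:
  "solution_map (\<lambda>i t k. 0) i t k = (if i = 0 then duhamel (C * \<bar>of_int k\<bar>) (a0 k) (\<lambda>s. 0) t else 0)"
  by (simp add: solution_map_def geometric_map_def nonlinearity_def conv_def)

lemma envelope_bounded_solution_map_zero: "envelope_bounded (1 / 2 * e) (solution_map (\<lambda>i t k. 0))"
  unfolding envelope_bounded_def
proof (intro allI impI)
  fix i :: nat and t :: real and k :: int assume t_nonneg: "0 \<le> t"
  consider (profile) "i = 0" "k \<noteq> 0" | (zero_mode) "i = 0" "k = 0" | (quotient) "i \<noteq> 0"
    by blast
  then show "cmod (solution_map (\<lambda>i t k. 0) i t k) \<le> 1 / 2 * e * envelope i t k"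
  proof cases
    case profile
    have "cmod (duhamel (C * \<bar>of_int k\<bar>) (a0 k) (\<lambda>s. 0) t) \<le>
        (\<bar>of_int k\<bar> ^ 3 * cmod (a0 k) + 4 * 0 / C) * envelope 0 t k"
      using profile t_nonneg by (intro norm_duhamel_le_envelope) auto
    also have "\<dots> \<le> 1 / 2 * e * envelope 0 t k"
      using a0_bound[of k] by (intro mult_right_mono envelope_nonneg) simp
    finally show ?thesis
      using profile by (simp add: solution_map_zero)
  next
    case zero_mode
    then show ?thesis
      using fourier_parity_odd_at_zero[OF a0_parity]
      by (simp add: solution_map_zero duhamel_def envelope_def)
  qed (use e_pos envelope_nonneg in \<open>simp add: solution_map_zero\<close>)
qed

lemma envelope_bounded_add:
  assumes "envelope_bounded r a" "envelope_bounded s b"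
  shows "envelope_bounded (r + s) (\<lambda>i t k. a i t k + b i t k)"
  using assms norm_triangle_mono unfolding envelope_bounded_def distrib_right by blast

lemma admissible_zero: "admissible (\<lambda>i t k. 0)"
  using e_pos envelope_nonneg
  by (simp add: admissible_def envelope_bounded_def time_continuous_def respects_parity_def
        fourier_parity_def)

lemma admissible_solution_map:
  assumes admissible: "admissible a"
  shows "admissible (solution_map a)"
proof -
  have "envelope_bounded e (\<lambda>i t k. a i t k - 0)"
    using admissible by (simp add: admissible_def)
  from solution_map_contraction[OF admissible admissible_zero this]
  have "envelope_bounded (1 / 2 * e) (\<lambda>i t k. solution_map a i t k - solution_map (\<lambda>i t k. 0) i t k)"
    using e_pos by simp
  then have "envelope_bounded e (solution_map a)"
    using envelope_bounded_add[OF envelope_bounded_solution_map_zero, of "1 / 2 * e"] by fastforce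
  then show ?thesis
    using admissible time_continuous_solution_map respects_parity_solution_map
    by (simp add: admissible_def)
qed

text \<open>Dividing by \<open>envelope\<close> turns the weighted sup norm into the norm of bounded continuous functions.\<close>
definition rescale :: "((nat \<times> real \<times> int) \<Rightarrow>\<^sub>C complex) \<Rightarrow> coeff_family" where
  "rescale u i t k = envelope i t k *\<^sub>R apply_bcontfun u (i, t, k)"

definition rescaled_solution_map ::
  "((nat \<times> real \<times> int) \<Rightarrow>\<^sub>C complex) \<Rightarrow> nat \<times> real \<times> int \<Rightarrow> complex" where
  "rescaled_solution_map u =
    (\<lambda>(i, t, k). solution_map (rescale u) i (max 0 t) k /\<^sub>R envelope i (max 0 t) k)"

lemma continuous_on_envelope: "continuous_on S (\<lambda>t. envelope i t k)"
  unfolding envelope_def damping_def exp_weight_def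
  by (cases "i = 0"; cases "k = 0") (auto intro!: continuous_intros simp: power_eq_0_iff add_pos_nonneg)

lemma time_continuous_rescale: "time_continuous (rescale u)"
  unfolding time_continuous_def rescale_def
  by (intro allI continuous_on_scaleR continuous_on_envelope continuous_intros
        continuous_on_compose2[OF continuous_on_apply_bcontfun[of UNIV u]]) auto

lemma rescaled_solution_map_in_bcontfun:
  assumes admissible_u: "admissible (rescale u)"
  shows "rescaled_solution_map u \<in> bcontfun"
proof (rule bcontfun_normI[where b = e])
  have admissible_image: "admissible (solution_map (rescale u))"
    by (rule admissible_solution_map[OF admissible_u])
  show "continuous_on UNIV (rescaled_solution_map u)"
  proof (rule continuous_on_discrete_params)
    fix i k
    have "continuous_on {0..} (\<lambda>t. solution_map (rescale u) i t k /\<^sub>R envelope i t k)"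
    proof (cases "i = 0 \<and> k = 0")
      case True
      then show ?thesis by (simp add: envelope_def)
    next
      case False
      then show ?thesis
        using admissible_image
        by (intro continuous_on_scaleR continuous_on_inverse continuous_on_envelope)
          (auto simp: admissible_def time_continuous_def envelope_eq_0_iff)
    qed
    then show "continuous_on UNIV (\<lambda>t. rescaled_solution_map u (i, t, k))"
      unfolding rescaled_solution_map_def prod.case
      by (rule continuous_on_compose2) (auto intro!: continuous_intros)
  qed
  show "norm (rescaled_solution_map u z) \<le> e" for z
  proof (cases z)
    case (fields i t k)
    have "cmod (solution_map (rescale u) i (max 0 t) k) \<le> e * envelope i (max 0 t) k"
      using admissible_image by (simp add: admissible_def envelope_bounded_def)
    from norm_divideR_le[OF this envelope_nonneg] show ?thesis
      using e_pos by (simp add: fields rescaled_solution_map_def)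
  qed
qed

lemma rescale_rescaled_solution_map:
  assumes admissible_u: "admissible (rescale u)"
    and v_eq: "apply_bcontfun v = rescaled_solution_map u" and t_nonneg: "0 \<le> t"
  shows "rescale v i t k = solution_map (rescale u) i t k"
proof -
  have "cmod (solution_map (rescale u) i t k) \<le> e * envelope i t k"
    using admissible_solution_map[OF admissible_u] t_nonneg
    by (simp add: admissible_def envelope_bounded_def)
  then show ?thesis
    using t_nonneg by (cases "envelope i t k = 0")
       (auto simp: rescale_def v_eq rescaled_solution_map_def max_def)
qed

lemma rescaled_solution_map_contraction:
  assumes admissible_u: "admissible (rescale u)" and admissible_v: "admissible (rescale v)"
  shows "dist (rescaled_solution_map u z) (rescaled_solution_map v z) \<le> 1 / 2 * dist u v"
proof (cases z)
  case (fields i t k)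
  have "cmod (rescale u i t k - rescale v i t k) \<le> dist u v * envelope i t k" for i t k
    using mult_left_mono[OF dist_bounded[of u "(i, t, k)" v] envelope_nonneg[of i t k]]
        envelope_nonneg[of i t k]
    by (simp add: rescale_def dist_norm[of "apply_bcontfun u _"] mult.commute flip: scaleR_diff_right)
  then have "envelope_bounded (dist u v) (\<lambda>i t k. rescale u i t k - rescale v i t k)"
    by (simp add: envelope_bounded_def)
  then have "envelope_bounded (1 / 2 * dist u v)
      (\<lambda>i t k. solution_map (rescale u) i t k - solution_map (rescale v) i t k)"
    by (intro solution_map_contraction admissible_u admissible_v) auto
  then have "cmod (solution_map (rescale u) i (max 0 t) k - solution_map (rescale v) i (max 0 t) k) \<le>
      1 / 2 * dist u v * envelope i (max 0 t) k"
    unfolding envelope_bounded_def by (meson max.cobounded1)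
  from norm_divideR_le[OF this envelope_nonneg] show ?thesis
    by (simp add: fields rescaled_solution_map_def dist_norm[of "_ *\<^sub>R _"] flip: scaleR_diff_right)
qed

lemma closed_admissible_rescale: "closed {u. admissible (rescale u)}"
proof -
  have "{u. admissible (rescale u)} =
      {u. envelope_bounded e (rescale u) \<and> respects_parity (rescale u)}"
    by (simp add: admissible_def time_continuous_rescale)
  also have "closed \<dots>"
    unfolding envelope_bounded_def respects_parity_def fourier_parity_def rescale_def
    by (intro closed_Collect_conj closed_Collect_all closed_Collect_imp closed_Collect_le
          closed_Collect_eq open_Collect_const continuous_intros continuous_on_eval_bcontfun)
  finally show ?thesis .
qed

lemma fixed_point_exists:
  obtains a where "admissible a" "\<And>i t. 0 \<le> t \<Longrightarrow> a i t = solution_map a i t"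
proof -
  define S where "S = {u. admissible (rescale u)}"
  define T where "T u = Bcontfun (rescaled_solution_map u)" for u
  have apply_T: "apply_bcontfun (T u) = rescaled_solution_map u" if "u \<in> S" for u
    using rescaled_solution_map_in_bcontfun that by (simp add: T_def S_def Bcontfun_inverse)
  have rescale_T: "rescale (T u) i t k = solution_map (rescale u) i t k" if "u \<in> S" "0 \<le> t" for u i t k
    using rescale_rescaled_solution_map[OF _ apply_T] that by (simp add: S_def)
  have "\<exists>!u\<in>S. T u = u"
  proof (rule Banach_fix)
    show "complete S"
      unfolding S_def
      by (rule complete_closed_subset[OF closed_admissible_rescale subset_UNIV complete_UNIV_bcontfun])
    have "rescale 0 = (\<lambda>i t k. 0)"
      by (simp add: rescale_def fun_eq_iff)
    then have "0 \<in> S"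
      by (simp add: S_def admissible_zero)
    then show "S \<noteq> {}" by auto
    show "T ` S \<subseteq> S"
    proof safe
      fix u assume u_in_S: "u \<in> S"
      then have "admissible (solution_map (rescale u))"
        by (simp add: S_def admissible_solution_map)
      then show "T u \<in> S"
        using rescale_T[OF u_in_S] time_continuous_rescale[of "T u"]
        by (simp add: S_def admissible_def envelope_bounded_def respects_parity_def
              fourier_parity_def)
    qed
    show "dist (T u) (T v) \<le> 1 / 2 * dist u v" if "u \<in> S" "v \<in> S" for u v
      using rescaled_solution_map_contraction[of u v] that apply_T
      by (intro dist_bound) (simp add: S_def)
  qed auto
  then obtain u where u_in_S: "u \<in> S" "T u = u" by auto
  show ?thesis
  proof (rule that[of "rescale u"])
    show "admissible (rescale u)" using u_in_S(1) by (simp add: S_def)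
    show "rescale u i t = solution_map (rescale u) i t" if "0 \<le> t" for i t
      using rescale_T[OF u_in_S(1) that] unfolding u_in_S(2) by auto
  qed
qed

end

section \<open>Sobolev regularity\<close>

lemma summable_power_exp_int:
  assumes "0 < c"
  shows "(\<lambda>k::int. (1 + (of_int k)^2)^3 * exp (- (c * \<bar>of_int k\<bar>)) :: real) summable_on UNIV"
proof -
  have "(\<lambda>n. (1 + (real n)^2)^3 * exp (- (c * real n))) \<in> O(\<lambda>n. inverse (real n ^ 2))"
    using assms by real_asymp
  then have "summable (\<lambda>n. (1 + (real n)^2)^3 * exp (- (c * real n)))"
    by (rule summable_comparison_test_bigo[rotated]) (simp add: inverse_power_summable)
  then have "summable (\<lambda>n. norm ((1 + (real n)^2)^3 * exp (- (c * real n))))"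
    by simp
  from summable_on_int_abs[OF norm_summable_imp_summable_on[OF this]] show ?thesis
    by simp
qed

lemma in_H3_of_exp_decay:
  assumes c_pos: "0 < c" and a_bound: "\<And>k. cmod (a k) \<le> B * exp (- (c * \<bar>of_int k\<bar>))"
    and of_real_g: "\<And>x. of_real (g x) = fourier_series a x"
  shows "in_H3 g"
proof -
  have "0 \<le> B"
    using order_trans[OF norm_ge_zero a_bound[of 0]] by simp
  have summable: "a summable_on UNIV"
  proof (rule summable_on_dominated[OF summable_on_cmult_right[OF summable_power_exp_int[OF c_pos]]])
    fix k
    have "1 * exp (- (c * \<bar>of_int k\<bar>)) \<le> (1 + (of_int k)^2)^3 * exp (- (c * \<bar>of_int k\<bar>))"
      by (intro mult_right_mono one_le_power) auto
    then show "cmod (a k) \<le> B * ((1 + (of_int k)^2)^3 * exp (- (c * \<bar>of_int k\<bar>)))"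
      using order_trans[OF a_bound mult_left_mono[OF _ \<open>0 \<le> B\<close>]] by simp
  qed
  have g_eq: "g x = Re (fourier_series a x)" for x
    by (simp flip: of_real_g)
  have "(\<lambda>k. (1 + (real_of_int k)^2)^3 * (cmod (a k))^2) summable_on UNIV"
  proof (rule summable_on_dominated[OF summable_on_cmult_right[OF summable_power_exp_int]])
    show "0 < 2 * c" using c_pos by simp
    fix k
    have "(cmod (a k))^2 \<le> (B * exp (- (c * \<bar>of_int k\<bar>)))^2"
      by (intro power_mono a_bound) simp
    also have "\<dots> = B^2 * exp (- (2 * c * \<bar>of_int k\<bar>))"
      by (simp add: power_mult_distrib flip: exp_double)
    finally have "(1 + (of_int k)^2)^3 * (cmod (a k))^2 \<le>
        (1 + (of_int k)^2)^3 * (B^2 * exp (- (2 * c * \<bar>of_int k\<bar>)))"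
      by (rule mult_left_mono) simp
    then show "norm ((1 + (real_of_int k)^2)^3 * (cmod (a k))^2) \<le>
        B^2 * ((1 + (of_int k)^2)^3 * exp (- (2 * c * \<bar>of_int k\<bar>)))"
      by (simp add: mult_ac)
  qed
  then show ?thesis
    using continuous_on_fourier_series[OF summable]
    by (simp add: in_H3_def periodic2pi_def fourier_coeff_eq_of_fourier_series[OF summable of_real_g]
          g_eq fourier_series_periodic continuous_on_Re)
qed

lemma cube_fourier_coeff_le_H3_norm:
  assumes "in_H3 f"
  shows "\<bar>of_int k\<bar> ^ 3 * cmod (fourier_coeff f k) \<le> H3_norm f"
proof -
  define g where "g k = (1 + (real_of_int k)^2)^3 * (cmod (fourier_coeff f k))^2" for k :: int
  have "(\<bar>of_int k\<bar> ^ 3 * cmod (fourier_coeff f k))^2 = ((of_int k)^2)^3 * (cmod (fourier_coeff f k))^2"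
    by (simp add: power_mult_distrib flip: power_mult)
  also have "\<dots> \<le> g k"
    unfolding g_def by (intro mult_right_mono power_mono) auto
  also have "\<dots> \<le> (\<Sum>\<^sub>\<infinity>k. g k)"
    using finite_sum_le_infsum[of g UNIV "{k}"] assms by (simp add: in_H3_def g_def[abs_def])
  finally show ?thesis
    unfolding H3_norm_def g_def[symmetric] by (rule real_le_rsqrt)
qed

section \<open>The solution\<close>

definition profile :: "coeff_family \<Rightarrow> real \<Rightarrow> real \<Rightarrow> real" where
  "profile a t x = Re (fourier_series (a 0 t) x)"

locale small_odd_solution = small_odd_data +
  fixes a :: coeff_family
  assumes admissible_coeffs: "admissible a"
    and coeffs_fixed_point: "\<And>i t. 0 \<le> t \<Longrightarrow> a i t = solution_map a i t"
begin

abbreviation f :: "real \<Rightarrow> real \<Rightarrow> real" where "f \<equiv> profile a"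

lemma envelope_bounded_coeffs: "envelope_bounded e a"
  using admissible_coeffs by (simp add: admissible_def)

lemma a_initial: "a 0 0 = a0"
  using coeffs_fixed_point[of 0 0] by (simp add: solution_map_def)

lemma coeff_parity: "0 \<le> t \<Longrightarrow> fourier_parity (- 1) (a 0 t)"
  using admissible_coeffs by (intro respects_parityD) (simp_all add: admissible_def)

lemma summable_coeffs:
  assumes "0 \<le> t"
  shows "a i t summable_on UNIV" "(\<lambda>k. of_int \<bar>k\<bar> * a 0 t k) summable_on UNIV"
    "(\<lambda>k. \<i> * of_int k * a 0 t k) summable_on UNIV" "nonlinearity a t summable_on UNIV"
proof -
  note summable = envelope_bounded_imp_weight_bounded_0[OF envelope_bounded_coeffs assms,
      THEN weight_bounded_imp_summable[OF _ order.refl]]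
  show "a i t summable_on UNIV"
    using summable(3,4) by (cases "i = 0") auto
  show "(\<lambda>k. of_int \<bar>k\<bar> * a 0 t k) summable_on UNIV" "(\<lambda>k. \<i> * of_int k * a 0 t k) summable_on UNIV"
    "nonlinearity a t summable_on UNIV"
    by (rule summable)+
qed

lemma of_real_f: "0 \<le> t \<Longrightarrow> of_real (f t x) = fourier_series (a 0 t) x"
  using fourier_parity_imp_real[OF coeff_parity[of t]] by (simp add: profile_def)

lemma f_has_real_derivative:
  assumes t_nonneg: "0 \<le> t"
  shows "(f t has_real_derivative Re (fourier_series (\<lambda>k. \<i> * of_int k * a 0 t k) x)) (at x)"
proof -
  have "(\<lambda>k. of_int k * a 0 t k) summable_on UNIV"
    using summable_on_cmult_right[OF summable_coeffs(3)[OF t_nonneg], of "- \<i>"]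
    by (simp add: mult.assoc[symmetric])
  from fourier_series_has_vector_derivative[OF summable_coeffs(1)[OF t_nonneg] this]
  show ?thesis
    unfolding profile_def[abs_def] has_real_derivative_iff_has_vector_derivative
    by (rule bounded_linear.has_vector_derivative[OF bounded_linear_Re])
qed

lemma of_real_deriv_f:
  assumes t_nonneg: "0 \<le> t"
  shows "of_real (deriv (f t) x) = fourier_series (\<lambda>k. \<i> * of_int k * a 0 t k) x"
  using fourier_parity_imp_real[OF fourier_parity_deriv[OF coeff_parity[OF t_nonneg]]]
  by (simp add: DERIV_imp_deriv[OF f_has_real_derivative[OF t_nonneg]])

lemma of_real_Lambda_f:
  assumes t_nonneg: "0 \<le> t"
  shows "of_real (Lambda (f t) x) = fourier_series (\<lambda>k. of_int \<bar>k\<bar> * a 0 t k) x"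
  using fourier_parity_imp_real[OF fourier_parity_abs[OF coeff_parity[OF t_nonneg]]]
  by (simp add: Lambda_fourier_series[OF summable_coeffs(1)[OF t_nonneg] of_real_f[OF t_nonneg]])

lemma f_C1_bounds:
  assumes t_nonneg: "0 \<le> t"
  shows "\<bar>f t x\<bar> \<le> conv_const * e * exp (- (C * t))"
    and "\<bar>deriv (f t) x\<bar> \<le> conv_const * e * exp (- (C * t))"
proof -
  have "cmod (fourier_series b x) \<le> conv_const * e * exp (- (C * t))"
    if "\<And>k. cmod (b k) \<le> \<bar>of_int k\<bar> * cmod (a 0 t k)" for b
    using norm_fourier_series_weight_bounded
      [OF weight_bounded_profile(2)[OF envelope_bounded_coeffs t_nonneg that]]
    by (simp add: mult_ac)
  then have "cmod (of_real (f t x)) \<le> conv_const * e * exp (- (C * t))"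
    "cmod (of_real (deriv (f t) x)) \<le> conv_const * e * exp (- (C * t))"
    unfolding of_real_f[OF t_nonneg] of_real_deriv_f[OF t_nonneg]
    using cmod_profile_le[OF envelope_bounded_coeffs t_nonneg] by (simp_all add: norm_mult)
  then show "\<bar>f t x\<bar> \<le> conv_const * e * exp (- (C * t))"
    "\<bar>deriv (f t) x\<bar> \<le> conv_const * e * exp (- (C * t))"
    by simp_all
qed

lemma C1_norm_f_le:
  assumes t_nonneg: "0 \<le> t"
  shows "C1_norm (f t) \<le> 2 * (conv_const * e) * exp (- (C * t))"
proof -
  have "C1_norm (f t) \<le> conv_const * e * exp (- (C * t)) + conv_const * e * exp (- (C * t))"
    unfolding C1_norm_def by (intro add_mono cSUP_least f_C1_bounds t_nonneg) auto
  then show ?thesis by simp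
qed

lemma f_in_H3:
  assumes t_pos: "0 < t"
  shows "in_H3 (f t)"
proof (rule in_H3_of_exp_decay[OF _ _ of_real_f])
  show "0 < C * t / 2" using C_pos t_pos by simp
  show "cmod (a 0 t k) \<le> e * exp (- (C * t / 2 * \<bar>of_int k\<bar>))" for k
  proof -
    have "envelope 0 t k \<le> exp (- (C * t / 2 * \<bar>of_int k\<bar>))"
    proof (cases "k = 0")
      case False
      then have "1 \<le> \<bar>real_of_int k\<bar> ^ 3" by (intro one_le_power) auto
      then have "damping t * exp (- (C * t / 2 * \<bar>of_int k\<bar>)) / \<bar>of_int k\<bar> ^ 3 \<le>
          1 * exp (- (C * t / 2 * \<bar>of_int k\<bar>)) / 1"
        using damping_le_1[of t] t_pos by (intro frac_le mult_right_mono) auto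
      then show ?thesis by (simp add: envelope_def)
    qed (simp add: envelope_def)
    moreover have "cmod (a 0 t k) \<le> e * envelope 0 t k"
      using envelope_bounded_coeffs t_pos by (simp add: envelope_bounded_def)
    ultimately show ?thesis
      using e_pos by (meson less_imp_le mult_left_mono order_trans)
  qed
qed (use t_pos in simp)

lemma f_square_less:
  assumes "0 \<le> t"
  shows "(f t x)^2 < 1 + l^2"
proof -
  have "\<bar>f t x\<bar> \<le> conv_const * e * 1"
    using C_pos assms conv_const_e_nonneg
    by (intro order_trans[OF f_C1_bounds(1)[OF assms]] mult_left_mono) auto
  then have "\<bar>f t x\<bar> < 1"
    using conv_const_e_le by linarith
  then have "(f t x)^2 < 1"
    by (simp add: abs_square_less_1)
  also have "1 \<le> 1 + l^2"
    by simp
  finally show ?thesis .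
qed

lemma fourier_series_slope_quotient:
  assumes t_nonneg: "0 \<le> t"
  shows "fourier_series (a 1 t) x = of_real ((deriv (f t) x)^2 / (1 + (deriv (f t) x)^2))"
proof -
  have equation: "a 1 t = geometric_map 1 (- 1) (\<lambda>k. \<i> * of_int k * a 0 t k) (a 1 t)"
    using coeffs_fixed_point[OF t_nonneg, of 1] by (simp add: solution_map_def)
  have "1 + (deriv (f t) x)^2 \<noteq> 0"
    by (metis add_pos_nonneg less_irrefl zero_le_power2 zero_less_one)
  then have "1 + complex_of_real (deriv (f t) x) ^ 2 \<noteq> 0"
    by (metis of_real_1 of_real_add of_real_eq_0_iff of_real_power)
  then show ?thesis
    using fourier_series_geometric_map_fixed_point[OF summable_coeffs(3,1)[OF t_nonneg] equation, of x]
    by (simp flip: of_real_deriv_f[OF t_nonneg])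
qed

lemma fourier_series_height_quotient:
  assumes t_nonneg: "0 \<le> t"
  shows "fourier_series (a 2 t) x = of_real (1 / (1 + l^2 - (f t x)^2) - 1 / (1 + l^2))"
proof -
  define u L where "u = f t x" and "L = 1 + l^2"
  have square_less: "u^2 < L" "0 < L"
    using f_square_less[OF t_nonneg, of x] by (auto simp: u_def L_def add_pos_nonneg)
  have equation: "a 2 t = geometric_map (of_real (1 / L^2)) (of_real (1 / L)) (a 0 t) (a 2 t)"
    using coeffs_fixed_point[OF t_nonneg, of 2] by (simp add: solution_map_def L_def)
  have "1 - u^2 / L \<noteq> 0"
    using square_less by simp
  moreover have "1 - of_real (1 / L) * complex_of_real u ^ 2 = of_real (1 - u^2 / L)"
    by simp
  ultimately have "fourier_series (a 2 t) x = of_real (1 / L^2 * u^2) / of_real (1 - u^2 / L)"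
    using fourier_series_geometric_map_fixed_point[OF summable_coeffs(1,1)[OF t_nonneg] equation, of x]
    by (simp only: u_def of_real_f[OF t_nonneg, symmetric] of_real_eq_0_iff of_real_mult
          of_real_power simp_thms)
  also have "\<dots> = of_real (1 / L^2 * u^2 / (1 - u^2 / L))"
    by simp
  also have "1 / L^2 * u^2 / (1 - u^2 / L) = 1 / (L - u^2) - 1 / L"
    using square_less by (simp add: field_simps power2_eq_square)
  finally show ?thesis
    by (simp only: u_def L_def)
qed

lemma fourier_series_nonlinearity:
  assumes t_nonneg: "0 \<le> t"
  shows "fourier_series (nonlinearity a t) x =
    of_real (((deriv (f t) x)^2 / (1 + (deriv (f t) x)^2) +
        (1 / (1 + l^2 - (f t x)^2) - 1 / (1 + l^2))) * Lambda (f t) x)"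
  unfolding nonlinearity_def of_real_mult of_real_add of_real_Lambda_f[OF t_nonneg]
    fourier_series_slope_quotient[OF t_nonneg, symmetric]
    fourier_series_height_quotient[OF t_nonneg, symmetric]
  by (simp only: fourier_series_conv fourier_series_add summable_on_add summable_coeffs[OF t_nonneg])

lemma coeff_has_vector_derivative:
  assumes t_nonneg: "0 \<le> t"
  shows "((\<lambda>t. a 0 t k) has_vector_derivative nonlinearity a t k - of_real C * (of_int \<bar>k\<bar> * a 0 t k))
    (at t within {0..})"
proof -
  define r where "r = C * \<bar>of_int k\<bar>"
  have coeff_eq: "a 0 s k = duhamel r (a0 k) (\<lambda>s. nonlinearity a s k) s" if "0 \<le> s" for s
    by (subst coeffs_fixed_point[OF that]) (simp add: solution_map_profile r_def)
  have "(duhamel r (a0 k) (\<lambda>s. nonlinearity a s k) has_vector_derivative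
      nonlinearity a t k - r *\<^sub>R a 0 t k) (at t within {0..})"
    using duhamel_has_vector_derivative[of "\<lambda>s. nonlinearity a s k" t r "a0 k"]
        continuous_on_nonlinearity[OF envelope_bounded_coeffs] admissible_coeffs t_nonneg
    by (simp add: coeff_eq admissible_def)
  then have "((\<lambda>t. a 0 t k) has_vector_derivative nonlinearity a t k - r *\<^sub>R a 0 t k)
      (at t within {0..})"
    by (rule has_vector_derivative_transform[rotated 2]) (use t_nonneg coeff_eq in auto)
  then show ?thesis
    by (simp add: r_def scaleR_conv_of_real mult.assoc flip: of_int_abs)
qed

lemma fourier_series_coeff_has_vector_derivative:
  assumes t_nonneg: "0 \<le> t"
  shows "((\<lambda>t. fourier_series (a 0 t) x) has_vector_derivative
    fourier_series (nonlinearity a t) x - C * fourier_series (\<lambda>k. of_int \<bar>k\<bar> * a 0 t k) x)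
    (at t within {0..})"
proof -
  define A where "A = 8 * (conv_const * e) * e + C * (4 * e)"
  have "((\<lambda>t. \<Sum>\<^sub>\<infinity>k. a 0 t k * cis (of_int k * x)) has_vector_derivative
      (\<Sum>\<^sub>\<infinity>k. (nonlinearity a t k - of_real C * (of_int \<bar>k\<bar> * a 0 t k)) * cis (of_int k * x)))
      (at t within {0..})"
  proof (rule has_vector_derivative_infsum_int)
    show "((\<lambda>t. a 0 t k * cis (of_int k * x)) has_vector_derivative
        (nonlinearity a s k - of_real C * (of_int \<bar>k\<bar> * a 0 s k)) * cis (of_int k * x))
        (at s within {0..})" if "s \<in> {0..}" for s k
      using coeff_has_vector_derivative[of s k] that by (auto intro!: derivative_eq_intros)
    show "(\<lambda>k. A * exp_weight 0 k) summable_on UNIV"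
      by (intro summable_on_cmult_right summable_exp_weight_0)
    show "cmod ((nonlinearity a s k - of_real C * (of_int \<bar>k\<bar> * a 0 s k)) * cis (of_int k * x)) \<le>
        A * exp_weight 0 k"
      if "s \<in> {0..}" for s k
    proof -
      have "weight_bounded 0 (8 * (conv_const * e) * e + cmod (- of_real C) * (4 * e))
          (\<lambda>k. nonlinearity a s k + - of_real C * (of_int \<bar>k\<bar> * a 0 s k))"
        using that by (intro weight_bounded_add weight_bounded_cmult
            envelope_bounded_imp_weight_bounded_0[OF envelope_bounded_coeffs]) auto
      then show ?thesis
        using C_pos by (simp add: weight_bounded_def A_def norm_mult mult.assoc)
    qed
    show "(\<lambda>k. a 0 s k * cis (of_int k * x)) summable_on UNIV" if "s \<in> {0..}" for s
      using that by (intro summable_on_fourier_series summable_coeffs) auto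
  qed (use t_nonneg in auto)
  moreover have "fourier_series (\<lambda>k. nonlinearity a t k + - of_real C * (of_int \<bar>k\<bar> * a 0 t k)) x =
      fourier_series (nonlinearity a t) x + - of_real C * fourier_series (\<lambda>k. of_int \<bar>k\<bar> * a 0 t k) x"
    by (simp only: fourier_series_cmult fourier_series_add[OF summable_coeffs(4)[OF t_nonneg]
          summable_on_cmult_right[OF summable_coeffs(2)[OF t_nonneg]]])
  ultimately show ?thesis
    by (simp add: fourier_series_def mult.assoc)
qed

lemma f_solves_equation:
  assumes t_nonneg: "0 \<le> t"
  shows "((\<lambda>s. f s x) has_real_derivative
    (- 1 / (1 + (deriv (f t) x)^2) + 1 / (1 + l^2 - (f t x)^2)) * Lambda (f t) x) (at t within {0..})"
proof -
  define q where "q = (deriv (f t) x)^2"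
  have "1 + q \<noteq> 0"
    by (metis q_def add_pos_nonneg less_irrefl zero_le_power2 zero_less_one)
  then have "q / (1 + q) + (1 / (1 + l^2 - (f t x)^2) - 1 / (1 + l^2)) - C =
      - 1 / (1 + q) + 1 / (1 + l^2 - (f t x)^2)"
    by (simp add: decay_rate_eq field_simps)
  moreover have "((\<lambda>s. f s x) has_real_derivative
      (q / (1 + q) + (1 / (1 + l^2 - (f t x)^2) - 1 / (1 + l^2)) - C) * Lambda (f t) x) (at t within
          {0..})"
    using bounded_linear.has_vector_derivative[OF bounded_linear_Re
        fourier_series_coeff_has_vector_derivative[OF t_nonneg, of x],
        folded profile_def]
    unfolding has_real_derivative_iff_has_vector_derivative fourier_series_nonlinearity[OF t_nonneg]
        of_real_Lambda_f[OF t_nonneg, symmetric]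
    by (simp add: q_def left_diff_distrib flip: of_real_mult of_real_diff)
  ultimately show ?thesis
    by (simp only: q_def)
qed

end

lemma in_H3_fourier_inversion:
  assumes in_H3: "in_H3 f0" and summable: "fourier_coeff f0 summable_on UNIV"
  shows "Re (fourier_series (fourier_coeff f0) x) = f0 x"
  using fourier_inversion[OF _ _ summable, of x] in_H3 by (simp add: in_H3_def complex_eq_iff)

lemma global_solution_of_small_odd_data:
  assumes l_pos: "0 < l"
    and e_bounds: "0 < e" "conv_const * e \<le> decay_rate l / 128" "conv_const * e \<le> l / 8"
    and f0_assms: "in_H3 f0" "\<And>x. f0 (- x) = - f0 x" "H3_norm f0 \<le> e / 2"
  obtains f where "f 0 = f0" "\<And>t. 0 \<le> t \<Longrightarrow> in_H3 (f t)"
    "\<And>t x. 0 \<le> t \<Longrightarrow> ((\<lambda>s. f s x) has_real_derivative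
      (- 1 / (1 + (deriv (f t) x)^2) + 1 / (1 + l^2 - (f t x)^2)) * Lambda (f t) x) (at t within {0..})"
    "\<And>t. 0 \<le> t \<Longrightarrow> C1_norm (f t) \<le> l / 4 * exp (- decay_rate l * t)"
proof -
  interpret small_odd_data l e "fourier_coeff f0"
  proof
    show "\<bar>of_int k\<bar> ^ 3 * cmod (fourier_coeff f0 k) \<le> e / 2" for k
      using cube_fourier_coeff_le_H3_norm[OF f0_assms(1)] f0_assms(3) by (rule order_trans)
  qed (use l_pos e_bounds f0_assms(2) fourier_parity_fourier_coeff_odd[of f0] in auto)
  obtain a where "admissible a" "\<And>i t. 0 \<le> t \<Longrightarrow> a i t = solution_map a i t"
    by (rule fixed_point_exists) blast
  then interpret small_odd_solution l e "fourier_coeff f0" a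
    by unfold_locales
  have "fourier_coeff f0 summable_on UNIV"
    using summable_coeffs(1)[of 0 0] by (simp add: a_initial)
  then have initial: "f 0 = f0"
    using f0_assms(1) by (auto simp: profile_def a_initial in_H3_fourier_inversion)
  show ?thesis
  proof (rule that[OF initial _ f_solves_equation])
    show "in_H3 (f t)" if "0 \<le> t" for t
      using f_in_H3[of t] initial f0_assms(1) that by (cases "t = 0") auto
    show "C1_norm (f t) \<le> l / 4 * exp (- decay_rate l * t)" if "0 \<le> t" for t
    proof -
      note C1_norm_f_le[OF that]
      also have "2 * (conv_const * e) * exp (- (C * t)) \<le> l / 4 * exp (- (C * t))"
        using e_bounds(3) by (intro mult_right_mono) auto
      finally show ?thesis by simp
    qed
  qed
qed

theorem theorem3:
  fixes l :: real
  assumes "l > 0"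
  shows "\<exists>\<delta>>0. \<forall>f0. in_H3 f0 \<and> (\<forall>x. f0 (-x) = - f0 x) \<and> (SUP x. \<bar>f0 x\<bar>) < l \<and>
            (\<forall>x. 1 / (1 + (deriv f0 x)^2) > 1 / (1 + l^2 - (f0 x)^2)) \<and>
            H3_norm f0 \<le> \<delta> \<longrightarrow>
          (\<exists>f :: real \<Rightarrow> real \<Rightarrow> real.
             f 0 = f0 \<and>
             (\<forall>t\<ge>0. in_H3 (f t)) \<and>
             (\<forall>t\<ge>0. \<forall>x. ((\<lambda>s. f s x) has_real_derivative
                  ((- 1 / (1 + (deriv (f t) x)^2) + 1 / (1 + l^2 - (f t x)^2)) * Lambda (f t) x))
                  (at t within {0..})) \<and>
             (\<forall>t\<ge>0. C1_norm (f t) \<le> l / 4 * exp (- (l^2 / (1 + l^2)) * t)))"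
proof -
  define e where "e = min (decay_rate l / 128) (l / 8) / conv_const"
  have "conv_const * e = min (decay_rate l / 128) (l / 8)"
    using conv_const_ge_1 by (simp add: e_def)
  then have e_bounds: "0 < e" "conv_const * e \<le> decay_rate l / 128" "conv_const * e \<le> l / 8"
    using assms decay_rate_pos[of l] conv_const_ge_1 by (auto simp: e_def)
  show ?thesis
  proof (intro exI[of _ "e / 2"] conjI allI impI; (elim conjE)?)
    show "0 < e / 2" using e_bounds by simp
    fix f0 assume "in_H3 f0" "\<forall>x. f0 (- x) = - f0 x" "H3_norm f0 \<le> e / 2"
    then obtain f where "f 0 = f0" "\<And>t. 0 \<le> t \<Longrightarrow> in_H3 (f t)"
      "\<And>t x. 0 \<le> t \<Longrightarrow> ((\<lambda>s. f s x) has_real_derivative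
        (- 1 / (1 + (deriv (f t) x)^2) + 1 / (1 + l^2 - (f t x)^2)) * Lambda (f t) x) (at t within
            {0..})"
      "\<And>t. 0 \<le> t \<Longrightarrow> C1_norm (f t) \<le> l / 4 * exp (- decay_rate l * t)"
      using global_solution_of_small_odd_data[OF assms e_bounds, of f0] by blast
    then show "\<exists>f. f 0 = f0 \<and> (\<forall>t\<ge>0. in_H3 (f t)) \<and>
             (\<forall>t\<ge>0. \<forall>x. ((\<lambda>s. f s x) has_real_derivative
                  ((- 1 / (1 + (deriv (f t) x)^2) + 1 / (1 + l^2 - (f t x)^2)) * Lambda (f t) x))
                  (at t within {0..})) \<and>
             (\<forall>t\<ge>0. C1_norm (f t) \<le> l / 4 * exp (- (l^2 / (1 + l^2)) * t))"
      unfolding decay_rate_def by blast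
  qed
qed

end
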